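(* For all extended configurations $\mathcal C_1,\mathcal C_2$: if $\mathcal L_{\mathsf{Hasco}}(\mathcal C_1)=\mathcal L_{\mathsf{Hasco}}(\mathcal C_2)$, i.e. $\mathcal C_1$ and $\mathcal C_2$ satisfy the same closed formulae of the logic $\mathcal L_{\mathsf{Hasco}}$, then $\mathcal C_1\approx_{\mathsf{Hasco}}\mathcal C_2$.
   Context: LANGUAGE. $\mathsf{Act}$ is an infinite set of actions with CCS complementation ($\bar{\bar a}=a$); $\tau\notin\mathsf{Act}$; $\mu$ ranges over $\mathsf{Act}\cup\{\tau\}$. Transaction names: $\mathsf{TrN}=\mathsf{inTrN}\uplus\mathsf{exTrN}$ (internal and external names, both infinite). Terms: $P,Q::=\sum_{i\in J}\mu_i.P_i$ ($J$ countable; $\mathbf 0$ is the empty sum) $\mid P\mid Q\mid\nu a.P\mid X\mid\mathrm{rec}X.P\mid[\![P\triangleright_kQ]\!]$ (running transaction named $k$) $\mid\mathrm{co}\mid[\![P\blacktriangleright Q]\!]$ (dormant transaction). $ftn(o)$ is the set of transaction names in $o$; $o\,\sharp\,o'$ means no transaction name of $o$ occurs in $o'$. A process is a well-formed term: (1) it is closed (no free process variables); (2) $ftn$ of it is finite; and for all subterms $[\![P_1\triangleright_kP_1']\!]$, $[\![P_2\blacktriangleright P_2']\!]$, $\sum\mu_i.Q_i$, $\mathrm{rec}X.R$: (3) $P_1,P_1',P_2,P_2',Q_i,R$ contain no transaction names; (4) $P_1,P_2,Q_i$ contain no dormant transactions; (5) $P_1,P_2$ are closed. PROCESS TRANSITIONS.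 $P\xrightarrow{\alpha}_\sigma Q$ with $\alpha\in\{a,\tau,k(\tau),k(a)\}$ and $\sigma$ a name substitution $\tilde k\mapsto l$ (domain the finite tuple $\tilde k$, possibly empty, range $\{l\}$; $\varepsilon$ alone is the empty substitution). Rules (symmetric ones omitted): - $\sum\mu_i.P_i\xrightarrow{\mu_j}_\varepsilon P_j$; - if $P\xrightarrow{a}_\varepsilon P'$ and $Q\xrightarrow{\bar a}_\varepsilon Q'$ then $P\mid Q\xrightarrow{\tau}_\varepsilon P'\mid Q'$; - $\mathrm{rec}X.P\xrightarrow{\tau}_\varepsilon P[\mathrm{rec}X.P/X]$; - if $\mu_j=a$ then $\sum\mu_i.P_i\xrightarrow{k(a)}_{\varepsilon\mapsto k}[\![P_j\mid\mathrm{co}\triangleright_k\sum\mu_i.P_i]\!]$; - if $P\xrightarrow{\mu}_\varepsilon P'$ and $k\,\sharp\,l$ then $[\![P\triangleright_lQ]\!]\xrightarrow{k(\mu)}_{l\mapsto k}[\![P'\triangleright_kQ]\!]$; - if $P\xrightarrow{k(a)}_{\sigma_1}P'$, $Q\xrightarrow{k(\bar a)}_{\sigma_2}Q'$, $\sigma_i=\tilde l_i\mapsto k$, then $P\mid Q\xrightarrow{k(\tau)}_{(\tilde l_1,\tilde l_2)\mapsto k}P'\sigma_2\mid Q'\sigma_1$; - if $P\xrightarrow{\alpha}_\sigma P'$ and $range(\sigma)\,\sharp\,Q$ then $P\mid Q\xrightarrow{\alpha}_\sigma P'\mid Q\sigma$; - if $P\xrightarrow{\alpha}_\sigma P'$ and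 $a$ does not occur in $\alpha$ then $\nu a.P\xrightarrow{\alpha}_\sigma\nu a.P'$. Reconfiguration transitions $P\xrightarrow{\beta}Q$, $\beta\in\{\mathrm{co}\,k,\mathrm{ab}\,k,\mathrm{new}\,k\}$ (symmetric rules omitted): - if $P\equiv\mathrm{co}\mid P''$ for some $P''$ and $P\rightsquigarrow_{\mathrm{co}}P'$ then $[\![P\triangleright_kQ]\!]\xrightarrow{\mathrm{co}\,k}P'$; - $[\![P\blacktriangleright Q]\!]\xrightarrow{\mathrm{new}\,k}[\![P\triangleright_kQ]\!]$; - $[\![P\triangleright_kQ]\!]\xrightarrow{\mathrm{ab}\,k}Q$; - for $\beta=\mathrm{co}\,k$ or $\mathrm{ab}\,k$: if $P\xrightarrow{\beta}P'$ and $Q\xrightarrow{\beta}Q'$ then $P\mid Q\xrightarrow{\beta}P'\mid Q'$; - if $P\xrightarrow{\beta}P'$ and $\beta\,\sharp\,Q$ then $P\mid Q\xrightarrow{\beta}P'\mid Q$; - if $P\xrightarrow{\beta}P'$ then $\nu a.P\xrightarrow{\beta}\nu a.P'$. Here $\equiv$ is standard CCS structural equivalence extended to transactions, and $\rightsquigarrow_{\mathrm{co}}$ is given by: $\mathrm{co}\rightsquigarrow_{\mathrm{co}}\mathbf 0$; sums, variables, $\mathrm{rec}X.P$ and $[\![P\blacktriangleright Q]\!]$ are related to themselves; it is compatible with $\nu a.-$ and $-\mid-$. EXTENDED CONFIGURATIONS AND $\approx_{\mathsf{Hasco}}$. $I$ is a countable index set. An extended configuration is $\langle E;H\bullet P\rangle$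 with $P$ a process, $E$ an equivalence relation over a finite subset of $\mathsf{TrN}$, and $H$ a finite partial function from $I$ to $\{k(a),k(\mathrm{ab}),k(\mathrm{co})\mid k\in\mathsf{exTrN},a\in\mathsf{Act}\}$. Let $H^{\mathrm{trn}}(i)$ be the name used in $H(i)$, $H^{\mathrm{trn}}$ the set of all these, and $\mathrm{Hasco}(H)=\{k\mid\exists i.\,H(i)=k(\mathrm{co})\}$. It is required that: (i) $H^{\mathrm{trn}}(i)=H^{\mathrm{trn}}(j)$ implies $i=j$; (ii) for $k\in\mathsf{exTrN}$, $k\,E\,k$ iff $k\in H^{\mathrm{trn}}$, and $k\,E\,k'$ implies ($k\in\mathrm{Hasco}(H)$ iff $k'\in\mathrm{Hasco}(H)$); (iii) $ftn(P)\cap\mathrm{Hasco}(H)=\emptyset$; (iv) $k\,E\,k'$ and $k,k'\in ftn(P)$ imply $k=k'$. Convention: external names of a configuration are those in its history, i.e. $ftn(P)\cap\mathsf{exTrN}\subseteq H^{\mathrm{trn}}$. "$H,k(a)$" denotes $H$ extended at a new index. For $\sigma=\tilde k\mapsto l$, $\sigma(E)$ is the smallest equivalence relation $F\supseteq E$ with $l\,F\,l$ and $k\,F\,l$ for all $k\in dom(\sigma)$. $(E;H)\setminus_{\mathrm{co}}k$ (resp. $\setminus_{\mathrm{ab}}k$) keeps $E$ and, for every $k'\,E\,k$, changes each $k'(a)$ in $H$ to $k'(\mathrm{co})$ (resp. $k'(\mathrm{ab})$). With $\Delta=E;H$, the extended transitions (labels $\zeta\in\{\tau,k(a)\}$) between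 extended configurations are: - $\langle\Delta\bullet P\rangle\xrightarrow{\tau}_e\langle\Delta\bullet Q\rangle$ if $P\xrightarrow{\tau}_\varepsilon Q$; - $\xrightarrow{\tau}_e\langle\sigma(E);H\bullet Q\rangle$ if $P\xrightarrow{k(\tau)}_\sigma Q$, $k\,\sharp\,E,H$, $k\in\mathsf{inTrN}$; - $\xrightarrow{\tau}_e\langle\Delta\bullet Q\rangle$ if $P\xrightarrow{\mathrm{new}\,k}Q$, $k\,\sharp\,\Delta$, $k\in\mathsf{inTrN}$; - $\xrightarrow{\tau}_e\langle\Delta\setminus_{\mathrm{co}}k\bullet Q\rangle$ if $P\xrightarrow{\mathrm{co}\,k}Q$; - $\xrightarrow{\tau}_e\langle\Delta\setminus_{\mathrm{ab}}k\bullet Q\rangle$ if $P\xrightarrow{\mathrm{ab}\,k}Q$; - $\xrightarrow{k(a)}_e\langle\sigma(E);H,k(a)\bullet Q\rangle$ if $P\xrightarrow{k(a)}_\sigma Q$, $k\,\sharp\,E,H$, $k\in\mathsf{exTrN}$; - $\xrightarrow{k(a)}_e\langle E,(k,k);H,k(\mathrm{ab})\bullet P\rangle$ if $k\,\sharp\,E,H,P$, $k\in\mathsf{exTrN}$. $\stackrel{\tau}{\Rightarrow}_e$ is $(\xrightarrow{\tau}_e)^*$ and $\stackrel{\zeta}{\Rightarrow}_e$ is $\stackrel{\tau}{\Rightarrow}_e\xrightarrow{\zeta}_e\stackrel{\tau}{\Rightarrow}_e$ otherwise. A relation $\mathcal R$ on extended configurations is a $\mathsf{Hasco}$-bisimulation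 if $\mathcal C_1\mathcal R\mathcal C_2$ implies: $\mathrm{Hasco}(\mathcal C_1)=\mathrm{Hasco}(\mathcal C_2)$ (the $\mathrm{Hasco}$ sets of their histories); and if $\mathcal C_1\stackrel{\zeta}{\Rightarrow}_e\mathcal C_1'$ with $\zeta\,\sharp\,\mathcal C_2$ then $\mathcal C_2\stackrel{\zeta}{\Rightarrow}_e\mathcal C_2'$ for some $\mathcal C_2'$ with $\mathcal C_1'\mathcal R\mathcal C_2'$; and conversely. $\approx_{\mathsf{Hasco}}$ is the largest one. LOGIC $\mathcal L_{\mathsf{Hasco}}$. $\mathsf{Var}$ is a countable set of variables disjoint from $\mathsf{exTrN}$. Formulae: $\phi::=\langle\tau\rangle\phi\mid\langle x(a)\rangle\phi\mid\neg\phi\mid\bigwedge_{i\in K}\phi_i$ ($K$ an arbitrary index set) $\mid\mathtt{Hasco}(v)$, with $x\in\mathsf{Var}$, $a\in\mathsf{Act}$, $v\in\mathsf{exTrN}\cup\mathsf{Var}$; $\langle x(a)\rangle\phi$ binds $x$ in $\phi$; closed formulae have no free variables (they may contain names, even infinitely many). Satisfaction for closed formulae: $\mathcal C\models\mathtt{Hasco}(k)$ iff $k\in\mathrm{Hasco}(\mathcal C)$; $\mathcal C\models\langle\tau\rangle\phi$ iff $\mathcal C\stackrel{\tau}{\Rightarrow}_e\mathcal C'$ with $\mathcal C'\models\phi$ for some $\mathcal C'$; $\mathcal C\models\langle x(a)\rangle\phi$ iff there is a cofinite $N\subseteq\mathsf{exTrN}$ such that for all $l\in N$ there is $\mathcal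 C'$ with $\mathcal C\stackrel{l(a)}{\Rightarrow}_e\mathcal C'$ and $\mathcal C'\models\phi[l/x]$; conjunction and negation are standard. $\mathcal L_{\mathsf{Hasco}}(\mathcal C)$ is the set of closed $\phi$ with $\mathcal C\models\phi$. *)

theory Defs
  imports Main "HOL-Library.Infinite_Typeclass"
begin

section \<open>Names and actions\<close>

text \<open>
  Terms are taken up to renaming of bound actions and of bound process variables, and both kinds
  of binders are represented by de Bruijn indices. (Named binders would not do: a countable sum
  may mention every action, so that no fresh name need exist for a capture-avoiding
  substitution.) Thus inside a term a channel is either a free one or the index of an enclosing
  restriction, while \<open>'c act\<close> is the set of actions proper; \<open>'c\<close> is the set of channels.
\<close>

datatype 'c chan = Free 'c | Bound nat

datatype 'n act = Name 'n | CoName 'n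

fun bar :: "'n act \<Rightarrow> 'n act" where
  "bar (Name n) = CoName n"
| "bar (CoName n) = Name n"

datatype 'n pfx = Tau | Act "'n act"

datatype ('m, 'k) trn = Internal 'm | External 'k


section \<open>Terms\<close>

text \<open>
  \<open>Sum f\<close> is the sum over the index set \<open>J = dom f\<close>, a subset of the natural
  numbers. \<open>Run P k Q\<close> and \<open>Dorm P Q\<close> are the running and the dormant transaction.
  The set function \<open>ftn\<close> collects all transaction names in a term, and \<open>map_tm\<close>
  renames them.
\<close>

datatype (dead 'c, ftn: 'k) tm =
    Sum "nat \<Rightarrow> ('c chan pfx \<times> ('c, 'k) tm) option"
  | Par "('c, 'k) tm" "('c, 'k) tm"
  | Res "('c, 'k) tm"
  | Var nat
  | Rec "('c, 'k) tm"
  | Run "('c, 'k) tm" 'k "('c, 'k) tm"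
  | Co
  | Dorm "('c, 'k) tm" "('c, 'k) tm"

abbreviation Null :: "('c, 'k) tm" where
  "Null \<equiv> Sum (\<lambda>_. None)"

text \<open>Renamings and substitutions of indices are extended under a binder by \<open>up\<close>.\<close>

definition up :: "(nat \<Rightarrow> nat) \<Rightarrow> nat \<Rightarrow> nat" where
  "up r = case_nat 0 (\<lambda>n. Suc (r n))"

primrec ren_chan :: "(nat \<Rightarrow> nat) \<Rightarrow> 'c chan \<Rightarrow> 'c chan" where
  "ren_chan r (Free c) = Free c"
| "ren_chan r (Bound n) = Bound (r n)"

abbreviation ren_pfx :: "(nat \<Rightarrow> nat) \<Rightarrow> 'c chan pfx \<Rightarrow> 'c chan pfx" where
  "ren_pfx r \<equiv> map_pfx (ren_chan r)"

text \<open>\<open>ren_act P r\<close> renames the loose restriction indices of \<open>P\<close>, \<open>ren_var P r\<close> its free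
  process variables.\<close>

primrec ren_act :: "('c, 'k) tm \<Rightarrow> (nat \<Rightarrow> nat) \<Rightarrow> ('c, 'k) tm" where
  "ren_act (Sum f) r =
     Sum (\<lambda>i. map_option (\<lambda>(\<mu>, g). (ren_pfx r \<mu>, g r)) (map_option (map_prod id ren_act) (f i)))"
| "ren_act (Par P Q) r = Par (ren_act P r) (ren_act Q r)"
| "ren_act (Res P) r = Res (ren_act P (up r))"
| "ren_act (Var n) r = Var n"
| "ren_act (Rec P) r = Rec (ren_act P r)"
| "ren_act (Run P k Q) r = Run (ren_act P r) k (ren_act Q r)"
| "ren_act Co r = Co"
| "ren_act (Dorm P Q) r = Dorm (ren_act P r) (ren_act Q r)"

primrec ren_var :: "('c, 'k) tm \<Rightarrow> (nat \<Rightarrow> nat) \<Rightarrow> ('c, 'k) tm" where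
  "ren_var (Sum f) r =
     Sum (\<lambda>i. map_option (\<lambda>(\<mu>, g). (\<mu>, g r)) (map_option (map_prod id ren_var) (f i)))"
| "ren_var (Par P Q) r = Par (ren_var P r) (ren_var Q r)"
| "ren_var (Res P) r = Res (ren_var P r)"
| "ren_var (Var n) r = Var (r n)"
| "ren_var (Rec P) r = Rec (ren_var P (up r))"
| "ren_var (Run P k Q) r = Run (ren_var P r) k (ren_var Q r)"
| "ren_var Co r = Co"
| "ren_var (Dorm P Q) r = Dorm (ren_var P r) (ren_var Q r)"

primrec subst :: "('c, 'k) tm \<Rightarrow> (nat \<Rightarrow> ('c, 'k) tm) \<Rightarrow> ('c, 'k) tm" where
  "subst (Sum f) s =
     Sum (\<lambda>i. map_option (\<lambda>(\<mu>, g). (\<mu>, g s)) (map_option (map_prod id subst) (f i)))"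
| "subst (Par P Q) s = Par (subst P s) (subst Q s)"
| "subst (Res P) s = Res (subst P (\<lambda>n. ren_act (s n) Suc))"
| "subst (Var n) s = s n"
| "subst (Rec P) s = Rec (subst P (case_nat (Var 0) (\<lambda>n. ren_var (s n) Suc)))"
| "subst (Run P k Q) s = Run (subst P s) k (subst Q s)"
| "subst Co s = Co"
| "subst (Dorm P Q) s = Dorm (subst P s) (subst Q s)"

definition unfold_rec :: "('c, 'k) tm \<Rightarrow> ('c, 'k) tm" where
  "unfold_rec P = subst P (case_nat (Rec P) Var)"


section \<open>Processes\<close>

inductive free_var :: "nat \<Rightarrow> ('c, 'k) tm \<Rightarrow> bool" where
  "f i = Some (\<mu>, P) \<Longrightarrow> free_var n P \<Longrightarrow> free_var n (Sum f)"
| "free_var n P \<Longrightarrow> free_var n (Par P Q)"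
| "free_var n Q \<Longrightarrow> free_var n (Par P Q)"
| "free_var n P \<Longrightarrow> free_var n (Res P)"
| "free_var n (Var n)"
| "free_var (Suc n) P \<Longrightarrow> free_var n (Rec P)"
| "free_var n P \<Longrightarrow> free_var n (Run P k Q)"
| "free_var n Q \<Longrightarrow> free_var n (Run P k Q)"
| "free_var n P \<Longrightarrow> free_var n (Dorm P Q)"
| "free_var n Q \<Longrightarrow> free_var n (Dorm P Q)"

definition closed_tm :: "('c, 'k) tm \<Rightarrow> bool" where
  "closed_tm P \<longleftrightarrow> (\<nexists>n. free_var n P)"

text \<open>\<open>loose n P\<close>: some action in \<open>P\<close> refers to the \<open>n\<close>-th restriction outside \<open>P\<close>.\<close>

inductive loose :: "nat \<Rightarrow> ('c, 'k) tm \<Rightarrow> bool" where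
  "f i = Some (\<mu>, P) \<Longrightarrow> Bound n \<in> set_pfx \<mu> \<Longrightarrow> loose n (Sum f)"
| "f i = Some (\<mu>, P) \<Longrightarrow> loose n P \<Longrightarrow> loose n (Sum f)"
| "loose n P \<Longrightarrow> loose n (Par P Q)"
| "loose n Q \<Longrightarrow> loose n (Par P Q)"
| "loose (Suc n) P \<Longrightarrow> loose n (Res P)"
| "loose n P \<Longrightarrow> loose n (Rec P)"
| "loose n P \<Longrightarrow> loose n (Run P k Q)"
| "loose n Q \<Longrightarrow> loose n (Run P k Q)"
| "loose n P \<Longrightarrow> loose n (Dorm P Q)"
| "loose n Q \<Longrightarrow> loose n (Dorm P Q)"

inductive subterm :: "('c, 'k) tm \<Rightarrow> ('c, 'k) tm \<Rightarrow> bool" where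
  "subterm P P"
| "f i = Some (\<mu>, P) \<Longrightarrow> subterm T P \<Longrightarrow> subterm T (Sum f)"
| "subterm T P \<Longrightarrow> subterm T (Par P Q)"
| "subterm T Q \<Longrightarrow> subterm T (Par P Q)"
| "subterm T P \<Longrightarrow> subterm T (Res P)"
| "subterm T P \<Longrightarrow> subterm T (Rec P)"
| "subterm T P \<Longrightarrow> subterm T (Run P k Q)"
| "subterm T Q \<Longrightarrow> subterm T (Run P k Q)"
| "subterm T P \<Longrightarrow> subterm T (Dorm P Q)"
| "subterm T Q \<Longrightarrow> subterm T (Dorm P Q)"

definition no_dormant :: "('c, 'k) tm \<Rightarrow> bool" where
  "no_dormant P \<longleftrightarrow> (\<nexists>P1 P2. subterm (Dorm P1 P2) P)"

text \<open>The condition on \<open>loose\<close> says that all actions of a process are genuine ones, i.e. that it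
  represents a named term.\<close>

definition process :: "('c, 'k) tm \<Rightarrow> bool" where
  "process P \<longleftrightarrow>
     (\<nexists>n. loose n P) \<and> closed_tm P \<and> finite (ftn P) \<and>
     (\<forall>P1 k P1'. subterm (Run P1 k P1') P \<longrightarrow>
        ftn P1 = {} \<and> ftn P1' = {} \<and> no_dormant P1 \<and> closed_tm P1) \<and>
     (\<forall>P2 P2'. subterm (Dorm P2 P2') P \<longrightarrow>
        ftn P2 = {} \<and> ftn P2' = {} \<and> no_dormant P2 \<and> closed_tm P2) \<and>
     (\<forall>f i \<mu> Q. subterm (Sum f) P \<longrightarrow> f i = Some (\<mu>, Q) \<longrightarrow> ftn Q = {} \<and> no_dormant Q) \<and>
     (\<forall>R. subterm (Rec R) P \<longrightarrow> ftn R = {})"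


section \<open>Structural equivalence and commitment\<close>

text \<open>In \<open>res_par\<close> the renaming \<open>Suc\<close> expresses that the restricted action is not free in \<open>Q\<close>.\<close>

inductive struct_eq :: "('c, 'k) tm \<Rightarrow> ('c, 'k) tm \<Rightarrow> bool" where
  refl: "struct_eq P P"
| sym: "struct_eq P Q \<Longrightarrow> struct_eq Q P"
| trans: "struct_eq P Q \<Longrightarrow> struct_eq Q R \<Longrightarrow> struct_eq P R"
| par_nil: "struct_eq (Par P Null) P"
| par_comm: "struct_eq (Par P Q) (Par Q P)"
| par_assoc: "struct_eq (Par (Par P Q) R) (Par P (Par Q R))"
| res_nil: "struct_eq (Res Null) Null"
| res_swap: "struct_eq (Res (Res P)) (Res (Res (ren_act P (id(0 := 1, 1 := 0)))))"
| res_par: "struct_eq (Par (Res P) Q) (Res (Par P (ren_act Q Suc)))"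
| sum_reindex: "bij_betw \<pi> (dom f) (dom g) \<Longrightarrow> (\<And>i. i \<in> dom f \<Longrightarrow> g (\<pi> i) = f i) \<Longrightarrow>
    struct_eq (Sum f) (Sum g)"
| cong_sum: "(\<And>i. rel_option (rel_prod (=) struct_eq) (f i) (g i)) \<Longrightarrow> struct_eq (Sum f) (Sum g)"
| cong_par: "struct_eq P P' \<Longrightarrow> struct_eq Q Q' \<Longrightarrow> struct_eq (Par P Q) (Par P' Q')"
| cong_res: "struct_eq P P' \<Longrightarrow> struct_eq (Res P) (Res P')"
| cong_rec: "struct_eq P P' \<Longrightarrow> struct_eq (Rec P) (Rec P')"
| cong_run: "struct_eq P P' \<Longrightarrow> struct_eq Q Q' \<Longrightarrow> struct_eq (Run P k Q) (Run P' k Q')"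
| cong_dorm: "struct_eq P P' \<Longrightarrow> struct_eq Q Q' \<Longrightarrow> struct_eq (Dorm P Q) (Dorm P' Q')"

inductive co_removal :: "('c, 'k) tm \<Rightarrow> ('c, 'k) tm \<Rightarrow> bool" where
  "co_removal Co Null"
| "co_removal (Sum f) (Sum f)"
| "co_removal (Var n) (Var n)"
| "co_removal (Rec P) (Rec P)"
| "co_removal (Dorm P Q) (Dorm P Q)"
| "co_removal P P' \<Longrightarrow> co_removal (Res P) (Res P')"
| "co_removal P P' \<Longrightarrow> co_removal Q Q' \<Longrightarrow> co_removal (Par P Q) (Par P' Q')"


section \<open>Process transitions\<close>

text \<open>\<open>Maps ks l\<close> is the substitution with domain the tuple \<open>ks\<close> and range \<open>{l}\<close>, which is
  distinct from \<open>Eps\<close> (of empty range) even when \<open>ks\<close> is empty.\<close>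

datatype 'k nsub = Eps | Maps "'k list" 'k

fun sdom :: "'k nsub \<Rightarrow> 'k set" where
  "sdom Eps = {}"
| "sdom (Maps ks l) = set ks"

fun srange :: "'k nsub \<Rightarrow> 'k set" where
  "srange Eps = {}"
| "srange (Maps ks l) = {l}"

fun nsub_apply :: "'k nsub \<Rightarrow> 'k \<Rightarrow> 'k" where
  "nsub_apply Eps k = k"
| "nsub_apply (Maps ks l) k = (if k \<in> set ks then l else k)"

abbreviation app_nsub :: "('c, 'k) tm \<Rightarrow> 'k nsub \<Rightarrow> ('c, 'k) tm" where
  "app_nsub P \<sigma> \<equiv> map_tm (nsub_apply \<sigma>) P"

datatype ('c, 'k) lab = Plain "'c chan pfx" | At 'k "'c chan pfx"

primrec lift_lab :: "('c, 'k) lab \<Rightarrow> ('c, 'k) lab" where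
  "lift_lab (Plain \<mu>) = Plain (ren_pfx Suc \<mu>)"
| "lift_lab (At k \<mu>) = At k (ren_pfx Suc \<mu>)"

text \<open>A label of the body of a restriction does not mention the restricted action (index 0) iff
  it is of the form \<open>lift_lab \<alpha>\<close>; outside the restriction it then reads \<open>\<alpha>\<close>.\<close>

inductive step :: "('c, 'k) tm \<Rightarrow> ('c, 'k) lab \<Rightarrow> 'k nsub \<Rightarrow> ('c, 'k) tm \<Rightarrow> bool" where
  sum: "f j = Some (\<mu>, P) \<Longrightarrow> step (Sum f) (Plain \<mu>) Eps P"
| comm: "step P (Plain (Act a)) Eps P' \<Longrightarrow> step Q (Plain (Act (bar a))) Eps Q' \<Longrightarrow>
    step (Par P Q) (Plain Tau) Eps (Par P' Q')"
| rec: "step (Rec P) (Plain Tau) Eps (unfold_rec P)"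
| sum_tr: "f j = Some (Act a, P) \<Longrightarrow>
    step (Sum f) (At k (Act a)) (Maps [] k) (Run (Par P Co) k (Sum f))"
| run: "step P (Plain \<mu>) Eps P' \<Longrightarrow> k \<noteq> l \<Longrightarrow>
    step (Run P l Q) (At k \<mu>) (Maps [l] k) (Run P' k Q)"
| comm_tr: "step P (At k (Act a)) (Maps ls1 k) P' \<Longrightarrow>
    step Q (At k (Act (bar a))) (Maps ls2 k) Q' \<Longrightarrow>
    step (Par P Q) (At k Tau) (Maps (ls1 @ ls2) k)
      (Par (app_nsub P' (Maps ls2 k)) (app_nsub Q' (Maps ls1 k)))"
| par1: "step P \<alpha> \<sigma> P' \<Longrightarrow> srange \<sigma> \<inter> ftn Q = {} \<Longrightarrow> step (Par P Q) \<alpha> \<sigma> (Par P' (app_nsub Q \<sigma>))"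
| par2: "step Q \<alpha> \<sigma> Q' \<Longrightarrow> srange \<sigma> \<inter> ftn P = {} \<Longrightarrow> step (Par P Q) \<alpha> \<sigma> (Par (app_nsub P \<sigma>) Q')"
| res: "step P (lift_lab \<alpha>) \<sigma> P' \<Longrightarrow> step (Res P) \<alpha> \<sigma> (Res P')"

datatype 'k rlab = CoL (rname: 'k) | AbL (rname: 'k) | NewL (rname: 'k)

inductive reconf :: "('c, 'k) tm \<Rightarrow> 'k rlab \<Rightarrow> ('c, 'k) tm \<Rightarrow> bool" where
  commit: "struct_eq P (Par Co P'') \<Longrightarrow> co_removal P P' \<Longrightarrow> reconf (Run P k Q) (CoL k) P'"
| new: "reconf (Dorm P Q) (NewL k) (Run P k Q)"
| abort: "reconf (Run P k Q) (AbL k) Q"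
| par_both: "\<beta> = CoL k \<or> \<beta> = AbL k \<Longrightarrow> reconf P \<beta> P' \<Longrightarrow> reconf Q \<beta> Q' \<Longrightarrow>
    reconf (Par P Q) \<beta> (Par P' Q')"
| par1: "reconf P \<beta> P' \<Longrightarrow> rname \<beta> \<notin> ftn Q \<Longrightarrow> reconf (Par P Q) \<beta> (Par P' Q)"
| par2: "reconf Q \<beta> Q' \<Longrightarrow> rname \<beta> \<notin> ftn P \<Longrightarrow> reconf (Par P Q) \<beta> (Par P Q')"
| res: "reconf P \<beta> P' \<Longrightarrow> reconf (Res P) \<beta> (Res P')"


section \<open>Extended configurations\<close>

datatype 'c status = Tentative "'c act" | Aborted | Committed

type_synonym ('c, 'k) hist = "nat \<rightharpoonup> 'k \<times> 'c status"

definition Htrn :: "('c, 'k) hist \<Rightarrow> 'k set" where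
  "Htrn H = fst ` ran H"

definition HascoH :: "('c, 'k) hist \<Rightarrow> 'k set" where
  "HascoH H = {k. \<exists>i. H i = Some (k, Committed)}"

datatype ('c, 'm, 'k) conf =
  Conf (eqv: "('m, 'k) trn rel") (hist: "('c, 'k) hist") (proc: "('c, ('m, 'k) trn) tm")

text \<open>The last conjunct is the convention that the external names of a configuration are those
  in its history.\<close>

fun ext_conf :: "('c, 'm, 'k) conf \<Rightarrow> bool" where
  "ext_conf (Conf E H P) \<longleftrightarrow>
     process P \<and> finite (Field E) \<and> equiv (Field E) E \<and> finite (dom H) \<and>
     (\<forall>i j k s t. H i = Some (k, s) \<longrightarrow> H j = Some (k, t) \<longrightarrow> i = j) \<and>
     (\<forall>k. (External k, External k) \<in> E \<longleftrightarrow> k \<in> Htrn H) \<and>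
     (\<forall>k k'. (External k, External k') \<in> E \<longrightarrow> (k \<in> HascoH H \<longleftrightarrow> k' \<in> HascoH H)) \<and>
     ftn P \<inter> External ` HascoH H = {} \<and>
     (\<forall>k k'. (k, k') \<in> E \<longrightarrow> k \<in> ftn P \<longrightarrow> k' \<in> ftn P \<longrightarrow> k = k') \<and>
     ftn P \<inter> range External \<subseteq> External ` Htrn H"

definition Hasco :: "('c, 'm, 'k) conf \<Rightarrow> 'k set" where
  "Hasco C = HascoH (hist C)"

definition delta_names :: "('m, 'k) trn rel \<Rightarrow> ('c, 'k) hist \<Rightarrow> ('m, 'k) trn set" where
  "delta_names E H = Field E \<union> External ` Htrn H"

definition conf_names :: "('c, 'm, 'k) conf \<Rightarrow> ('m, 'k) trn set" where
  "conf_names C = delta_names (eqv C) (hist C) \<union> ftn (proc C)"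

text \<open>\<open>equiv (Field F) F\<close> says that \<open>F\<close> is an equivalence relation over some set of names.\<close>

definition sub_eqv :: "'k nsub \<Rightarrow> 'k rel \<Rightarrow> 'k rel" where
  "sub_eqv \<sigma> E = \<Inter> {F. equiv (Field F) F \<and> E \<subseteq> F \<and>
     (\<forall>l \<in> srange \<sigma>. (l, l) \<in> F \<and> (\<forall>k \<in> sdom \<sigma>. (k, l) \<in> F))}"

text \<open>\<open>resolve s E k H\<close> is the history of \<open>(E;H)\<close> after the commit (\<open>s = Committed\<close>) or
  abort (\<open>s = Aborted\<close>) of \<open>k\<close>.\<close>

definition resolve ::
    "'c status \<Rightarrow> ('m, 'k) trn rel \<Rightarrow> ('m, 'k) trn \<Rightarrow> ('c, 'k) hist \<Rightarrow> ('c, 'k) hist" where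
  "resolve s E k H = (\<lambda>i. case H i of
       Some (k', Tentative a) \<Rightarrow> Some (k', if (External k', k) \<in> E then s else Tentative a)
     | x \<Rightarrow> x)"

datatype ('c, 'k) elab = TauE | ActE 'k "'c act"

primrec elab_names :: "('c, 'k) elab \<Rightarrow> ('m, 'k) trn set" where
  "elab_names TauE = {}"
| "elab_names (ActE k a) = {External k}"

abbreviation free_act :: "'c act \<Rightarrow> 'c chan act" where
  "free_act \<equiv> map_act Free"

inductive raw_estep :: "('c, 'm, 'k) conf \<Rightarrow> ('c, 'k) elab \<Rightarrow> ('c, 'm, 'k) conf \<Rightarrow> bool" where
  tau: "step P (Plain Tau) Eps Q \<Longrightarrow> raw_estep (Conf E H P) TauE (Conf E H Q)"
| tr_tau: "step P (At k Tau) \<sigma> Q \<Longrightarrow> k \<notin> delta_names E H \<Longrightarrow> k \<in> range Internal \<Longrightarrow>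
    raw_estep (Conf E H P) TauE (Conf (sub_eqv \<sigma> E) H Q)"
| new: "reconf P (NewL k) Q \<Longrightarrow> k \<notin> delta_names E H \<Longrightarrow> k \<in> range Internal \<Longrightarrow>
    raw_estep (Conf E H P) TauE (Conf E H Q)"
| commit: "reconf P (CoL k) Q \<Longrightarrow>
    raw_estep (Conf E H P) TauE (Conf E (resolve Committed E k H) Q)"
| abort: "reconf P (AbL k) Q \<Longrightarrow>
    raw_estep (Conf E H P) TauE (Conf E (resolve Aborted E k H) Q)"
| tr_act: "step P (At (External k) (Act (free_act a))) \<sigma> Q \<Longrightarrow> External k \<notin> delta_names E H \<Longrightarrow>
    i \<notin> dom H \<Longrightarrow>
    raw_estep (Conf E H P) (ActE k a) (Conf (sub_eqv \<sigma> E) (H(i \<mapsto> (k, Tentative a))) Q)"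
| tr_ab: "External k \<notin> delta_names E H \<Longrightarrow> External k \<notin> ftn P \<Longrightarrow> i \<notin> dom H \<Longrightarrow>
    raw_estep (Conf E H P) (ActE k a)
      (Conf (insert (External k, External k) E) (H(i \<mapsto> (k, Aborted))) P)"

text \<open>The transitions are between extended configurations.\<close>

definition estep :: "('c, 'm, 'k) conf \<Rightarrow> ('c, 'k) elab \<Rightarrow> ('c, 'm, 'k) conf \<Rightarrow> bool" where
  "estep C \<zeta> C' \<longleftrightarrow> ext_conf C \<and> ext_conf C' \<and> raw_estep C \<zeta> C'"

definition tau_steps :: "('c, 'm, 'k) conf \<Rightarrow> ('c, 'm, 'k) conf \<Rightarrow> bool" where
  "tau_steps = (\<lambda>C C'. estep C TauE C')\<^sup>*\<^sup>*"

fun weak :: "('c, 'm, 'k) conf \<Rightarrow> ('c, 'k) elab \<Rightarrow> ('c, 'm, 'k) conf \<Rightarrow> bool" where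
  "weak C TauE C' \<longleftrightarrow> tau_steps C C'"
| "weak C (ActE k a) C' \<longleftrightarrow>
     (\<exists>D D'. tau_steps C D \<and> estep D (ActE k a) D' \<and> tau_steps D' C')"


section \<open>Bisimilarity\<close>

definition hasco_bisimulation :: "('c, 'm, 'k) conf rel \<Rightarrow> bool" where
  "hasco_bisimulation R \<longleftrightarrow>
     (\<forall>C1 C2. (C1, C2) \<in> R \<longrightarrow>
        ext_conf C1 \<and> ext_conf C2 \<and> Hasco C1 = Hasco C2 \<and>
        (\<forall>\<zeta> C1'. weak C1 \<zeta> C1' \<longrightarrow> elab_names \<zeta> \<inter> conf_names C2 = {} \<longrightarrow>
           (\<exists>C2'. weak C2 \<zeta> C2' \<and> (C1', C2') \<in> R)) \<and>
        (\<forall>\<zeta> C2'. weak C2 \<zeta> C2' \<longrightarrow> elab_names \<zeta> \<inter> conf_names C1 = {} \<longrightarrow>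
           (\<exists>C1'. weak C1 \<zeta> C1' \<and> (C1', C2') \<in> R)))"

definition hasco_bisimilar :: "('c, 'm, 'k) conf rel" where
  "hasco_bisimilar = \<Union> {R. hasco_bisimulation R}"


section \<open>The logic\<close>

datatype 'k ref = RName 'k | RVar nat

text \<open>Conjunctions are families over subsets of the index type \<open>'j\<close>: \<open>Conj f\<close> is the
  conjunction over \<open>K = dom f\<close>.\<close>

datatype ('c, 'k, 'j) form =
    DiaTau "('c, 'k, 'j) form"
  | DiaAct nat "'c act" "('c, 'k, 'j) form"
  | Neg "('c, 'k, 'j) form"
  | Conj "'j \<Rightarrow> ('c, 'k, 'j) form option"
  | HascoF "'k ref"

inductive free_in :: "nat \<Rightarrow> ('c, 'k, 'j) form \<Rightarrow> bool" where
  "free_in x \<phi> \<Longrightarrow> free_in x (DiaTau \<phi>)"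
| "free_in x \<phi> \<Longrightarrow> x \<noteq> y \<Longrightarrow> free_in x (DiaAct y a \<phi>)"
| "free_in x \<phi> \<Longrightarrow> free_in x (Neg \<phi>)"
| "f i = Some \<phi> \<Longrightarrow> free_in x \<phi> \<Longrightarrow> free_in x (Conj f)"
| "free_in x (HascoF (RVar x))"

definition closed_form :: "('c, 'k, 'j) form \<Rightarrow> bool" where
  "closed_form \<phi> \<longleftrightarrow> (\<nexists>x. free_in x \<phi>)"

primrec fsubst :: "'k \<Rightarrow> nat \<Rightarrow> ('c, 'k, 'j) form \<Rightarrow> ('c, 'k, 'j) form" where
  "fsubst l x (DiaTau \<phi>) = DiaTau (fsubst l x \<phi>)"
| "fsubst l x (DiaAct y a \<phi>) = DiaAct y a (if x = y then \<phi> else fsubst l x \<phi>)"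
| "fsubst l x (Neg \<phi>) = Neg (fsubst l x \<phi>)"
| "fsubst l x (Conj f) = Conj (\<lambda>i. map_option (fsubst l x) (f i))"
| "fsubst l x (HascoF v) = HascoF (if v = RVar x then RName l else v)"

text \<open>For the termination of \<open>sat\<close>: \<open>shape\<close> erases the arguments of \<open>HascoF\<close> and is thus
  invariant under substitution.\<close>

primrec shape :: "('c, 'k, 'j) form \<Rightarrow> ('c, 'k, 'j) form" where
  "shape (DiaTau \<phi>) = DiaTau (shape \<phi>)"
| "shape (DiaAct y a \<phi>) = DiaAct y a (shape \<phi>)"
| "shape (Neg \<phi>) = Neg (shape \<phi>)"
| "shape (Conj f) = Conj (\<lambda>i. map_option shape (f i))"
| "shape (HascoF v) = HascoF (RVar 0)"

lemma shape_fsubst: "shape (fsubst l x \<phi>) = shape \<phi>"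
proof (induction \<phi>)
  case (Conj f)
  have "map_option shape (map_option (fsubst l x) (f i)) = map_option shape (f i)" for i
  proof (cases "f i")
    case (Some \<psi>)
    have "shape (fsubst l x \<psi>) = shape \<psi>"
      by (rule Conj[OF rangeI[of f i]]) (simp add: Some)
    with Some show ?thesis by (simp only: option.map)
  qed simp
  then show ?case
    by (simp only: fsubst.simps shape.simps)
qed simp_all

inductive child :: "('c, 'k, 'j) form \<Rightarrow> ('c, 'k, 'j) form \<Rightarrow> bool" where
  "child \<phi> (DiaTau \<phi>)"
| "child \<phi> (DiaAct y a \<phi>)"
| "child \<phi> (Neg \<phi>)"
| "f i = Some \<phi> \<Longrightarrow> child \<phi> (Conj f)"

lemma wf_child: "wf {(\<phi>, \<psi> :: ('c, 'k, 'j) form). child \<phi> \<psi>}"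
proof (rule wfUNIVI)
  fix P :: "('c, 'k, 'j) form \<Rightarrow> bool" and \<phi>
  assume "\<forall>\<psi>. (\<forall>\<phi>. (\<phi>, \<psi>) \<in> {(\<phi>, \<psi>). child \<phi> \<psi>} \<longrightarrow> P \<phi>) \<longrightarrow> P \<psi>"
  then have step: "P \<psi>" if "\<And>\<phi>. child \<phi> \<psi> \<Longrightarrow> P \<phi>" for \<psi>
    using that by blast
  show "P \<phi>"
  proof (induction \<phi>)
    case (Conj f)
    show ?case
    proof (rule step)
      fix \<psi> assume "child \<psi> (Conj f)"
      then obtain i where "f i = Some \<psi>"
        by cases
      then show "P \<psi>"
        using Conj[OF rangeI[of f i], of \<psi>] by (simp only: option.set simp_thms insert_iff)
    qed
  qed (rule step, erule child.cases, simp_all)+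
qed

text \<open>Satisfaction is meaningful for closed formulae only; the value at an open
  \<open>HascoF (RVar x)\<close> is arbitrary.\<close>

function sat :: "('c, 'm, 'k) conf \<Rightarrow> ('c, 'k, 'j) form \<Rightarrow> bool" where
  "sat C (DiaTau \<phi>) \<longleftrightarrow> (\<exists>C'. weak C TauE C' \<and> sat C' \<phi>)"
| "sat C (DiaAct x a \<phi>) \<longleftrightarrow>
     (\<exists>N. finite (- N) \<and> (\<forall>l \<in> N. \<exists>C'. weak C (ActE l a) C' \<and> sat C' (fsubst l x \<phi>)))"
| "sat C (Neg \<phi>) \<longleftrightarrow> \<not> sat C \<phi>"
| "sat C (Conj f) \<longleftrightarrow> (\<forall>i \<phi>. f i = Some \<phi> \<longrightarrow> sat C \<phi>)"
| "sat C (HascoF (RName k)) \<longleftrightarrow> k \<in> Hasco C"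
| "sat C (HascoF (RVar x)) \<longleftrightarrow> False"
  by pat_completeness auto
termination
proof (relation "inv_image {(\<phi>, \<psi>). child \<phi> \<psi>} (shape \<circ> snd)", goal_cases)
  case (5 C f i \<phi>)
  then have "child (shape \<phi>) (Conj (\<lambda>i. map_option shape (f i)))"
    by (intro child.intros(4)[where i = i]) (simp only: option.map)
  then show ?case
    by simp
qed (simp_all add: wf_child shape_fsubst child.intros(1-3))

text \<open>A datatype must bound the index sets \<open>K\<close> of conjunctions. Subsets of the type of
  configurations are enough to characterise bisimilarity; since they embed into those of any
  larger index type, agreement of two configurations there implies agreement here.\<close>

definition theory_of :: "('c, 'm, 'k) conf \<Rightarrow> ('c, 'k, ('c, 'm, 'k) conf) form set" where
  "theory_of C = {\<phi>. closed_form \<phi> \<and> sat C \<phi>}"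

end

theory Submission
  imports Defs
begin

text \<open>
  Call two configurations logically equal if they agree on the closed formulae whose names occur in
  their histories. This is a bisimulation. A weak move \<open>C \<Rightarrow> C'\<close> changes the finite set of
  external names at most by adding the label, so if no answer \<open>D'\<close> of \<open>D\<close> were logically equal to
  \<open>C'\<close>, the conjunction \<open>\<phi>\<close> of formulae separating \<open>C'\<close> from all \<open>D'\<close> would have names in a finite
  set \<open>S\<close>, plus the label \<open>k\<close>. For a silent move \<open>\<langle>\<tau>\<rangle>\<phi>\<close> separates \<open>C\<close> from \<open>D\<close>. For a move \<open>k(a)\<close>
  the formula \<open>\<langle>x(a)\<rangle>\<phi>[x/k]\<close> does: transitions and satisfaction are invariant under swapping \<open>k\<close>
  with a name \<open>l\<close> outside \<open>S\<close>, the swap fixes \<open>C\<close> and \<open>D\<close>, and it turns \<open>\<phi>\<close> into \<open>\<phi>[l/k]\<close>.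
\<close>

section \<open>Equivariance of the process transitions\<close>

lemma map_tm_Sum: "map_tm g (Sum f) = Sum (\<lambda>i. map_option (map_prod id (map_tm g)) (f i))"
  by (simp add: comp_def map_prod_def id_def)

text \<open>The defining equation first turns each summand into a function of \<open>r\<close> and
  then applies it. Fusing the two maps gives all operations the same \<open>map_prod\<close> shape
  on sums, so that their compositions can be compared summand by summand.\<close>

lemma ren_act_Sum:
  "ren_act (Sum f) r = Sum (\<lambda>i. map_option (map_prod (ren_pfx r) (\<lambda>P. ren_act P r)) (f i))"
  by (auto simp: option.map_comp comp_def split_def map_prod_def intro!: ext option.map_cong)

lemma ren_var_Sum:
  "ren_var (Sum f) r = Sum (\<lambda>i. map_option (map_prod id (\<lambda>P. ren_var P r)) (f i))"
  by (auto simp: option.map_comp comp_def split_def map_prod_def intro!: ext option.map_cong)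

lemma subst_Sum:
  "subst (Sum f) s = Sum (\<lambda>i. map_option (map_prod id (\<lambda>P. subst P s)) (f i))"
  by (auto simp: option.map_comp comp_def split_def map_prod_def intro!: ext option.map_cong)

text \<open>The generated rule reaches the summands through ranges, options and pairs; here the
  hypothesis is offered directly for every summand of \<open>f\<close>.\<close>

lemma tm_induct [case_names Sum Par Res Var Rec Run Co Dorm]:
  assumes "\<And>f. (\<And>i \<mu> P. f i = Some (\<mu>, P) \<Longrightarrow> \<Phi> P) \<Longrightarrow> \<Phi> (Sum f)"
    and "\<And>P Q. \<Phi> P \<Longrightarrow> \<Phi> Q \<Longrightarrow> \<Phi> (Par P Q)"
    and "\<And>P. \<Phi> P \<Longrightarrow> \<Phi> (Res P)"
    and "\<And>n. \<Phi> (Var n)"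
    and "\<And>P. \<Phi> P \<Longrightarrow> \<Phi> (Rec P)"
    and "\<And>P k Q. \<Phi> P \<Longrightarrow> \<Phi> Q \<Longrightarrow> \<Phi> (Run P k Q)"
    and "\<Phi> Co"
    and "\<And>P Q. \<Phi> P \<Longrightarrow> \<Phi> Q \<Longrightarrow> \<Phi> (Dorm P Q)"
  shows "\<Phi> P"
proof (induction P)
  case (Sum f)
  show ?case
  proof (rule assms(1))
    fix i \<mu> P assume "f i = Some (\<mu>, P)"
    then show "\<Phi> P"
      using Sum[OF rangeI[of f i], of "(\<mu>, P)" P] by simp
  qed
qed (use assms in auto)

lemma map_tm_ren_act: "map_tm g (ren_act P r) = ren_act (map_tm g P) r"
proof (induction P arbitrary: r rule: tm_induct)
  case (Sum f)
  show ?case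
    unfolding map_tm_Sum ren_act_Sum
    by (auto simp: option.map_comp Sum intro!: ext option.map_cong)
qed auto

lemma map_tm_ren_var: "map_tm g (ren_var P r) = ren_var (map_tm g P) r"
proof (induction P arbitrary: r rule: tm_induct)
  case (Sum f)
  show ?case
    unfolding map_tm_Sum ren_var_Sum
    by (auto simp: option.map_comp Sum intro!: ext option.map_cong)
qed auto

text \<open>The inserted terms may carry transaction names themselves, so the renaming is applied to
  \<open>s\<close> as well. The case of \<open>Rec\<close> rests on \<open>map_tm\<close> commuting
  with the shift of variables, that of \<open>Res\<close> on the same for actions.\<close>

lemma map_tm_subst: "map_tm g (subst P s) = subst (map_tm g P) (\<lambda>n. map_tm g (s n))"
proof (induction P arbitrary: s rule: tm_induct)
  case (Sum f)
  show ?case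
    unfolding map_tm_Sum subst_Sum
    by (auto simp: option.map_comp Sum intro!: ext option.map_cong)
next
  case (Rec P)
  have "(\<lambda>n. map_tm g (case n of 0 \<Rightarrow> Var 0 | Suc n \<Rightarrow> ren_var (s n) Suc)) =
      case_nat (Var 0) (\<lambda>n. ren_var (map_tm g (s n)) Suc)"
    by (auto simp: map_tm_ren_var split: nat.split)
  with Rec show ?case by simp
qed (auto simp: map_tm_ren_act)

lemma map_tm_unfold_rec: "map_tm g (unfold_rec P) = unfold_rec (map_tm g P)"
proof -
  have "(\<lambda>n. map_tm g (case n of 0 \<Rightarrow> Rec P | Suc n \<Rightarrow> Var n)) =
      case_nat (Rec (map_tm g P)) Var"
    by (auto split: nat.split)
  then show ?thesis by (simp add: unfold_rec_def map_tm_subst)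
qed

section \<open>Renaming in structural equivalence, process transitions and reconfigurations\<close>

lemma struct_eq_map: "struct_eq P Q \<Longrightarrow> struct_eq (map_tm g P) (map_tm g Q)"
proof (induction rule: struct_eq.induct)
  case (sum_reindex \<pi> f f')
  show ?case
    unfolding map_tm_Sum
    \<comment> \<open>Renaming keeps the index set of a sum, so the same bijection serves.\<close>
    by (rule struct_eq.sum_reindex[of \<pi>]) (use sum_reindex in \<open>simp_all add: dom_map_option\<close>)
next
  case (cong_sum f f')
  have "rel_option (rel_prod (=) struct_eq)
      (map_option (map_prod id (map_tm g)) (f i)) (map_option (map_prod id (map_tm g)) (f' i))" for i
    using cong_sum[of i] by (cases "f i"; cases "f' i") auto
  then show ?case
    unfolding map_tm_Sum by (rule struct_eq.cong_sum)
next
  case (trans P Q R) then show ?case by (blast intro: struct_eq.trans)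
qed (auto intro: struct_eq.intros struct_eq.res_swap[unfolded One_nat_def] simp: map_tm_ren_act)

lemma co_removal_map: "co_removal P Q \<Longrightarrow> co_removal (map_tm g P) (map_tm g Q)"
  by (induction rule: co_removal.induct) (auto intro: co_removal.intros)

text \<open>Injectivity ensures that a renamed name lies in the renamed domain tuple only if the
  original name lies in the original tuple.\<close>

lemma nsub_apply_map: "inj g \<Longrightarrow> nsub_apply (map_nsub g \<sigma>) (g k) = g (nsub_apply \<sigma> k)"
  by (cases \<sigma>) (auto dest: injD)

lemma app_nsub_map:
  "inj g \<Longrightarrow> map_tm g (app_nsub P \<sigma>) = app_nsub (map_tm g P) (map_nsub g \<sigma>)"
  by (simp add: tm.map_comp comp_def nsub_apply_map)

lemma srange_map: "srange (map_nsub g \<sigma>) = g ` srange \<sigma>"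
  by (cases \<sigma>) auto

lemma sdom_map: "sdom (map_nsub g \<sigma>) = g ` sdom \<sigma>"
  by (cases \<sigma>) auto

lemmas map_idents =
  chan.map_id0 chan.map_ident act.map_id0 act.map_ident pfx.map_id0 pfx.map_ident id_def[symmetric]

lemma lift_lab_map: "map_lab id g (lift_lab \<alpha>) = lift_lab (map_lab id g \<alpha>)"
  by (cases \<alpha>) (auto simp: pfx.map_comp act.map_comp chan.map_comp comp_def map_idents)

text \<open>Positive premises survive any renaming. Injectivity serves the negative ones, namely the
  freshness of \<open>k\<close> in \<open>run\<close> and of the range in \<open>par1\<close> and
  \<open>par2\<close>, and lets the renaming pass through the substitutions applied to
  components.\<close>

lemma step_map:
  assumes "inj g" and "step P \<alpha> \<sigma> Q"
  shows "step (map_tm g P) (map_lab id g \<alpha>) (map_nsub g \<sigma>) (map_tm g Q)"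
  using assms(2)
proof (induction rule: step.induct)
  case (sum f j \<mu> P)
  then show ?case
    unfolding map_tm_Sum by (auto intro!: step.sum[where j = j] simp: map_idents)
next
  case (sum_tr f j a P k)
  have "step (map_tm g (Sum f)) (At (g k) (Act a)) (Maps [] (g k))
     (Run (Par (map_tm g P) Co) (g k) (map_tm g (Sum f)))"
    unfolding map_tm_Sum by (rule step.sum_tr[where j = j]) (simp add: sum_tr)
  then show ?case by (simp add: map_idents)
next
  case (run P \<mu> P' k l Q)
  then show ?case using assms(1) by (auto intro!: step.run dest: injD)
next
  case (comm_tr P k a ls1 P' Q ls2 Q')
  then show ?case
    using assms(1)
    by (auto simp: app_nsub_map map_idents intro!: step.comm_tr)
next
  case (par1 P \<alpha> \<sigma> P' Q)
  then show ?case
    using assms(1)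
    by (auto simp: app_nsub_map srange_map tm.set_map intro!: step.par1 dest!: injD[OF assms(1)])
next
  case (par2 Q \<alpha> \<sigma> Q' P)
  then show ?case
    using assms(1)
    by (auto simp: app_nsub_map srange_map tm.set_map intro!: step.par2 dest!: injD[OF assms(1)])
qed (auto intro: step.intros simp: map_tm_unfold_rec lift_lab_map map_idents)

lemma rname_map: "rname (map_rlab g \<beta>) = g (rname \<beta>)"
  by (cases \<beta>) auto

lemma reconf_map:
  assumes "inj g" and "reconf P \<beta> Q"
  shows "reconf (map_tm g P) (map_rlab g \<beta>) (map_tm g Q)"
  using assms(2)
proof (induction rule: reconf.induct)
  case (commit P P'' P' k Q)
  then show ?case
    using struct_eq_map[of P "Par Co P''" g] by (auto intro!: reconf.commit co_removal_map)
next
  case (par_both \<beta> k P P' Q Q')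
  then show ?case by (auto intro!: reconf.par_both[where k = "g k"])
next
  case par1
  then show ?case
    using assms(1) by (auto simp: rname_map tm.set_map dest: injD intro!: reconf.par1)
next
  case par2
  then show ?case
    using assms(1) by (auto simp: rname_map tm.set_map dest: injD intro!: reconf.par2)
qed (auto intro: reconf.intros)

section \<open>Well-formedness of renamed processes\<close>

lemma loose_simps:
  "loose n (Sum f) \<longleftrightarrow> (\<exists>i \<mu> P. f i = Some (\<mu>, P) \<and> (Bound n \<in> set_pfx \<mu> \<or> loose n P))"
  "loose n (Par P Q) \<longleftrightarrow> loose n P \<or> loose n Q"
  "loose n (Res P) \<longleftrightarrow> loose (Suc n) P"
  "\<not> loose n (Var m)"
  "loose n (Rec P) \<longleftrightarrow> loose n P"
  "loose n (Run P k Q) \<longleftrightarrow> loose n P \<or> loose n Q"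
  "\<not> loose n Co"
  "loose n (Dorm P Q) \<longleftrightarrow> loose n P \<or> loose n Q"
  by (subst loose.simps, force)+

lemma free_var_simps:
  "free_var n (Sum f) \<longleftrightarrow> (\<exists>i \<mu> P. f i = Some (\<mu>, P) \<and> free_var n P)"
  "free_var n (Par P Q) \<longleftrightarrow> free_var n P \<or> free_var n Q"
  "free_var n (Res P) \<longleftrightarrow> free_var n P"
  "free_var n (Var m) \<longleftrightarrow> n = m"
  "free_var n (Rec P) \<longleftrightarrow> free_var (Suc n) P"
  "free_var n (Run P k Q) \<longleftrightarrow> free_var n P \<or> free_var n Q"
  "\<not> free_var n Co"
  "free_var n (Dorm P Q) \<longleftrightarrow> free_var n P \<or> free_var n Q"
  by (subst free_var.simps, force)+

lemma subterm_simps: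
  "subterm T (Sum f) \<longleftrightarrow> T = Sum f \<or> (\<exists>i \<mu> P. f i = Some (\<mu>, P) \<and> subterm T P)"
  "subterm T (Par P Q) \<longleftrightarrow> T = Par P Q \<or> subterm T P \<or> subterm T Q"
  "subterm T (Res P) \<longleftrightarrow> T = Res P \<or> subterm T P"
  "subterm T (Var m) \<longleftrightarrow> T = Var m"
  "subterm T (Rec P) \<longleftrightarrow> T = Rec P \<or> subterm T P"
  "subterm T (Run P k Q) \<longleftrightarrow> T = Run P k Q \<or> subterm T P \<or> subterm T Q"
  "subterm T Co \<longleftrightarrow> T = Co"
  "subterm T (Dorm P Q) \<longleftrightarrow> T = Dorm P Q \<or> subterm T P \<or> subterm T Q"
  by (subst subterm.simps, force)+

lemma loose_map: "loose n (map_tm g P) \<longleftrightarrow> loose n P"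
proof (induction P arbitrary: n rule: tm_induct)
  case (Sum f)
  then show ?case unfolding map_tm_Sum loose_simps by (fastforce simp: map_prod_def)
qed (simp_all add: loose_simps)

lemma free_var_map: "free_var n (map_tm g P) \<longleftrightarrow> free_var n P"
proof (induction P arbitrary: n rule: tm_induct)
  case (Sum f)
  then show ?case unfolding map_tm_Sum free_var_simps by (fastforce simp: map_prod_def)
qed (simp_all add: free_var_simps)

lemma closed_tm_map: "closed_tm (map_tm g P) \<longleftrightarrow> closed_tm P"
  by (simp add: closed_tm_def free_var_map)

text \<open>This pulls the conditions that \<open>process\<close> puts on all subterms of a renamed
  term back to subterms of the original one.\<close>

lemma subterm_map:
  "subterm T (map_tm g P) \<Longrightarrow> \<exists>T'. T = map_tm g T' \<and> subterm T' P"
proof (induction P arbitrary: T rule: tm_induct)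
  case (Sum f)
  from Sum.prems consider "T = map_tm g (Sum f)"
    | i \<mu> P where "f i = Some (\<mu>, P)" "subterm T (map_tm g P)"
    unfolding map_tm_Sum subterm_simps by (auto simp: map_prod_def)
  then show ?case
  proof cases
    case 1
    then show ?thesis by (metis subterm.intros(1))
  next
    case 2
    then show ?thesis using Sum.IH by (meson subterm.intros(2))
  qed
qed (simp_all add: subterm_simps; metis tm.map)+

lemma no_dormant_map:
  assumes "no_dormant P"
  shows "no_dormant (map_tm g P)"
  unfolding no_dormant_def
proof safe
  fix P1 P2 assume "subterm (Dorm P1 P2) (map_tm g P)"
  then obtain T where T: "Dorm P1 P2 = map_tm g T" "subterm T P"
    using subterm_map by metis
  then obtain Q1 Q2 where "T = Dorm Q1 Q2" by (cases T) auto
  with T assms show False by (auto simp: no_dormant_def)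
qed

lemma process_map:
  assumes "process P"
  shows "process (map_tm g P)"
proof -
  have run: "ftn P1 = {} \<and> ftn P1' = {} \<and> no_dormant P1 \<and> closed_tm P1"
    if sub: "subterm (Run P1 k P1') (map_tm g P)" for P1 k P1'
  proof -
    obtain T where T: "Run P1 k P1' = map_tm g T" "subterm T P"
      using subterm_map[OF sub] by metis
    then obtain Q1 l Q2 where "T = Run Q1 l Q2" by (cases T) auto
    with T assms show ?thesis
      by (auto simp: process_def tm.set_map closed_tm_map intro: no_dormant_map)
  qed
  have dorm: "ftn P1 = {} \<and> ftn P1' = {} \<and> no_dormant P1 \<and> closed_tm P1"
    if sub: "subterm (Dorm P1 P1') (map_tm g P)" for P1 P1'
  proof -
    obtain T where T: "Dorm P1 P1' = map_tm g T" "subterm T P"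
      using subterm_map[OF sub] by metis
    then obtain Q1 Q2 where "T = Dorm Q1 Q2" by (cases T) auto
    with T assms show ?thesis
      by (auto simp: process_def tm.set_map closed_tm_map intro: no_dormant_map)
  qed
  have sum: "ftn Q = {} \<and> no_dormant Q"
    if sub: "subterm (Sum f) (map_tm g P)" and fi: "f i = Some (\<mu>, Q)" for f i \<mu> Q
  proof -
    obtain T where T: "Sum f = map_tm g T" "subterm T P"
      using subterm_map[OF sub] by metis
    then obtain h where h: "T = Sum h" by (cases T) auto
    with T fi obtain Q' where "Q = map_tm g Q'" "h i = Some (\<mu>, Q')"
      by (auto simp: map_tm_Sum simp del: tm.map)
    with T h assms show ?thesis
      by (auto simp: process_def tm.set_map intro: no_dormant_map)
  qed
  have rec: "ftn R = {}" if sub: "subterm (Rec R) (map_tm g P)" for R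
  proof -
    obtain T where T: "Rec R = map_tm g T" "subterm T P"
      using subterm_map[OF sub] by metis
    then obtain Q where "T = Rec Q" by (cases T) auto
    with T assms show ?thesis by (auto simp: process_def tm.set_map)
  qed
  show ?thesis
    unfolding process_def
    using run dorm sum rec assms
    by (auto simp: process_def loose_map closed_tm_map tm.set_map)
qed

section \<open>Equivariance of the extended transitions\<close>

text \<open>Internal names stay fixed: labels, histories and formulae mention external names only,
  and rules that demand an internal name remain applicable.\<close>

abbreviation ren_trn :: "('k \<Rightarrow> 'k) \<Rightarrow> ('m, 'k) trn \<Rightarrow> ('m, 'k) trn" where
  "ren_trn \<pi> \<equiv> map_trn id \<pi>"

abbreviation ren_rel :: "('a \<Rightarrow> 'b) \<Rightarrow> 'a rel \<Rightarrow> 'b rel" where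
  "ren_rel g \<equiv> image (map_prod g g)"

abbreviation ren_hist :: "('k \<Rightarrow> 'k) \<Rightarrow> ('c, 'k) hist \<Rightarrow> ('c, 'k) hist" where
  "ren_hist \<pi> H \<equiv> \<lambda>i. map_option (map_prod \<pi> id) (H i)"

fun ren_conf :: "('k \<Rightarrow> 'k) \<Rightarrow> ('c, 'm, 'k) conf \<Rightarrow> ('c, 'm, 'k) conf" where
  "ren_conf \<pi> (Conf E H P) =
     Conf (ren_rel (ren_trn \<pi>) E) (ren_hist \<pi> H) (map_tm (ren_trn \<pi>) P)"

lemma bij_ren_trn: "bij \<pi> \<Longrightarrow> bij (ren_trn \<pi>)"
proof (rule bijI)
  assume "bij \<pi>"
  then show "inj (ren_trn \<pi>)" by (intro trn.inj_map) (auto simp: bij_is_inj)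
  show "surj (ren_trn \<pi>)"
  proof (rule surjI)
    fix x show "ren_trn \<pi> (ren_trn (inv \<pi>) x) = x"
      using \<open>bij \<pi>\<close> by (cases x) (auto simp: bij_is_surj surj_f_inv_f)
  qed
qed

section \<open>Renaming of equivalences, histories and configurations\<close>

lemma Field_ren_rel: "Field (ren_rel g E) = g ` Field E"
  by (force simp: Field_def)

lemma Htrn_ren: "Htrn (ren_hist \<pi> H) = \<pi> ` Htrn H"
  by (force simp: Htrn_def ran_def)

lemma HascoH_ren: "HascoH (ren_hist \<pi> H) = \<pi> ` HascoH H"
  by (force simp: HascoH_def)

lemma delta_names_ren:
  "delta_names (ren_rel (ren_trn \<pi>) E) (ren_hist \<pi> H) = ren_trn \<pi> ` delta_names E H"
  by (simp add: delta_names_def Field_ren_rel Htrn_ren image_Un image_image)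

lemma dom_ren_hist: "dom (ren_hist \<pi> H) = dom H"
  by auto

text \<open>Reflexivity on the field follows: \<open>(x, y)\<close> and its converse compose to
  \<open>(x, x)\<close> and \<open>(y, y)\<close>.\<close>

lemma equiv_Field_iff: "equiv (Field E) E \<longleftrightarrow> sym E \<and> trans E"
  by (auto simp: equiv_def refl_on_def Field_def dest: symD transD)

lemma equiv_ren_rel:
  assumes "inj g" and "equiv (Field E) E"
  shows "equiv (Field (ren_rel g E)) (ren_rel g E)"
  using assms unfolding equiv_Field_iff
  by (auto intro!: symI transI dest!: injD[OF assms(1)] dest: symD transD)

lemma mem_ren_rel: "inj g \<Longrightarrow> (g x, g y) \<in> ren_rel g E \<longleftrightarrow> (x, y) \<in> E"
  by (auto dest: injD)

lemma mem_ren_rel_External: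
  "inj \<pi> \<Longrightarrow> (External (\<pi> k), External (\<pi> k')) \<in> ren_rel (ren_trn \<pi>) E \<longleftrightarrow>
    (External k, External k') \<in> E"
  using mem_ren_rel[OF trn.inj_map[OF inj_on_id], of \<pi> "External k" "External k'" E] by simp

text \<open>Renaming turns every relation competing in the intersection for \<open>\<sigma>\<close>
  and \<open>E\<close> into one competing for the renamed data. Since \<open>map_prod g g\<close> is
  a bijection, taking images commutes with the intersection.\<close>

lemma sub_eqv_ren_subset:
  fixes g :: "'a \<Rightarrow> 'a"
  assumes "bij g"
  shows "sub_eqv (map_nsub g \<sigma>) (ren_rel g E) \<subseteq> ren_rel g (sub_eqv \<sigma> E)"
proof -
  have inj: "inj g" using assms by (simp add: bij_is_inj)
  let ?A = "{F. equiv (Field F) F \<and> E \<subseteq> F \<and>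
     (\<forall>l \<in> srange \<sigma>. (l, l) \<in> F \<and> (\<forall>k \<in> sdom \<sigma>. (k, l) \<in> F))}"
  have "bij (map_prod g g)"
    using assms by (simp add: bij_def prod.inj_map map_prod_surj)
  then have *: "ren_rel g (sub_eqv \<sigma> E) = (\<Inter>F\<in>?A. ren_rel g F)"
    unfolding sub_eqv_def[of \<sigma> E] using bij_image_INT[of "map_prod g g" "\<lambda>F. F" ?A] by simp
  have "sub_eqv (map_nsub g \<sigma>) (ren_rel g E) \<subseteq> ren_rel g F" if "F \<in> ?A" for F
    unfolding sub_eqv_def
    by (rule Inter_lower)
      (use that in \<open>auto simp: srange_map sdom_map mem_ren_rel[OF inj] intro!: equiv_ren_rel inj\<close>)
  then show ?thesis
    unfolding * by (rule INT_greatest)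
qed

lemma sub_eqv_ren:
  fixes g :: "'a \<Rightarrow> 'a"
  assumes "bij g"
  shows "sub_eqv (map_nsub g \<sigma>) (ren_rel g E) = ren_rel g (sub_eqv \<sigma> E)"
proof
  show "sub_eqv (map_nsub g \<sigma>) (ren_rel g E) \<subseteq> ren_rel g (sub_eqv \<sigma> E)"
    by (rule sub_eqv_ren_subset[OF assms])
  have g: "g (inv g x) = x" "inv g (g x) = x" for x
    using assms by (simp_all add: bij_is_surj surj_f_inv_f bij_is_inj)
  have ig: "ren_rel (inv g) (ren_rel g X) = X" "ren_rel g (ren_rel (inv g) X) = X" for X
    by (force simp: g)+
  have \<sigma>: "map_nsub (inv g) (map_nsub g \<sigma>) = \<sigma>"
    by (cases \<sigma>) (auto simp: g intro!: map_idI)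
  \<comment> \<open>The inclusion already shown, for \<open>inv g\<close> and the renamed data,
    yields the converse one after renaming by \<open>g\<close>.\<close>
  have "sub_eqv \<sigma> E \<subseteq> ren_rel (inv g) (sub_eqv (map_nsub g \<sigma>) (ren_rel g E))"
    using sub_eqv_ren_subset[OF bij_imp_bij_inv[OF assms], of "map_nsub g \<sigma>" "ren_rel g E"]
    by (simp add: \<sigma> ig)
  then show "ren_rel g (sub_eqv \<sigma> E) \<subseteq> sub_eqv (map_nsub g \<sigma>) (ren_rel g E)"
    using ig(2) by (metis image_mono)
qed

lemma resolve_ren:
  assumes "inj \<pi>"
  shows "resolve s (ren_rel (ren_trn \<pi>) E) (ren_trn \<pi> k) (ren_hist \<pi> H) =
    ren_hist \<pi> (resolve s E k H)"
proof
  fix i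
  have *: "(External (\<pi> k'), ren_trn \<pi> k) \<in> ren_rel (ren_trn \<pi>) E \<longleftrightarrow> (External k', k) \<in> E" for k'
    using mem_ren_rel[OF trn.inj_map[OF inj_on_id assms], of "External k'" k E] by simp
  show "resolve s (ren_rel (ren_trn \<pi>) E) (ren_trn \<pi> k) (ren_hist \<pi> H) i =
      ren_hist \<pi> (resolve s E k H) i"
    by (auto simp: resolve_def * split: option.split status.split simp del: map_prod_imageI)
qed

text \<open>The invariants are pulled back: surjectivity writes an arbitrary name as an image, and
  injectivity reflects membership in the renamed sets and relations.\<close>

lemma ext_conf_ren:
  fixes C :: "('c, 'm, 'k) conf"
  assumes "bij \<pi>" and "ext_conf C"
  shows "ext_conf (ren_conf \<pi> C)"
proof (cases C)
  case (Conf E H P)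
  let ?g = "ren_trn \<pi> :: ('m, 'k) trn \<Rightarrow> ('m, 'k) trn" and ?E = "ren_rel (ren_trn \<pi>) E" and ?H = "ren_hist \<pi> H"
    and ?P = "map_tm (ren_trn \<pi>) P"
  have inj: "inj \<pi>" and surj: "\<And>k. \<exists>k'. k = \<pi> k'"
    using assms(1) by (auto simp: bij_def surj_def)
  have ginj: "inj ?g" and gsurj: "\<And>k. \<exists>k'. k = ?g k'"
    using bij_ren_trn[OF assms(1)] unfolding bij_def surj_def by auto
  have mem: "\<pi> x \<in> \<pi> ` A \<longleftrightarrow> x \<in> A" for x A
    using inj by (simp add: inj_image_mem_iff)
  have gmem: "?g x \<in> ?g ` A \<longleftrightarrow> x \<in> A" for x A
    using ginj by (simp add: inj_image_mem_iff)
  have C: "process P" "finite (Field E)" "equiv (Field E) E" "finite (dom H)"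
     "\<And>i j k s t. H i = Some (k, s) \<Longrightarrow> H j = Some (k, t) \<Longrightarrow> i = j"
     "\<And>k. (External k, External k) \<in> E \<longleftrightarrow> k \<in> Htrn H"
     "\<And>k k'. (External k, External k') \<in> E \<Longrightarrow> (k \<in> HascoH H \<longleftrightarrow> k' \<in> HascoH H)"
     "ftn P \<inter> External ` HascoH H = {}"
     "\<And>k k'. (k, k') \<in> E \<Longrightarrow> k \<in> ftn P \<Longrightarrow> k' \<in> ftn P \<Longrightarrow> k = k'"
     "ftn P \<inter> range External \<subseteq> External ` Htrn H"
    using assms(2) unfolding Conf by simp_all
  have "i = j" if "?H i = Some (k, s)" "?H j = Some (k, t)" for i j k s t
    using that inj by (auto intro!: C(5) dest: injD)
  moreover have "(External k, External k) \<in> ?E \<longleftrightarrow> k \<in> Htrn ?H" for k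
  proof -
    obtain k' where "k = \<pi> k'" using surj by blast
    then show ?thesis using C(6) by (simp only: mem_ren_rel_External[OF inj] Htrn_ren mem)
  qed
  moreover have "k \<in> HascoH ?H \<longleftrightarrow> k' \<in> HascoH ?H" if "(External k, External k') \<in> ?E" for k k'
  proof -
    obtain l l' where "k = \<pi> l" "k' = \<pi> l'" using surj by blast
    then show ?thesis
      using that C(7) by (simp only: mem_ren_rel_External[OF inj] HascoH_ren mem)
  qed
  moreover have "ftn ?P \<inter> External ` HascoH ?H = {}"
  proof -
    have "External ` HascoH ?H = ?g ` External ` HascoH H"
      by (simp add: HascoH_ren image_image)
    then show ?thesis
      using C(8) ginj by (simp add: tm.set_map image_Int[symmetric])
  qed
  moreover have "k = k'" if "(k, k') \<in> ?E" "k \<in> ftn ?P" "k' \<in> ftn ?P" for k k'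
  proof -
    obtain l l' where l: "k = ?g l" "k' = ?g l'" using gsurj by blast
    have "(l, l') \<in> E" "l \<in> ftn P" "l' \<in> ftn P"
      using that unfolding l by (simp_all only: mem_ren_rel[OF ginj] tm.set_map gmem)
    then show ?thesis using C(9) l by blast
  qed
  moreover have "ftn ?P \<inter> range External \<subseteq> External ` Htrn ?H"
  proof -
    \<comment> \<open>A name that is external after renaming was external before, so the convention
      on external names can be applied to \<open>P\<close>.\<close>
    have "x \<in> range External" if "?g x \<in> range External" for x
      using that by (cases x) auto
    then have "ftn ?P \<inter> range External \<subseteq> ?g ` (ftn P \<inter> range External)"
      unfolding tm.set_map by blast
    also have "\<dots> \<subseteq> ?g ` External ` Htrn H"
      by (rule image_mono[OF C(10)])
    also have "\<dots> = External ` Htrn ?H"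
      by (simp add: Htrn_ren image_image)
    finally show ?thesis .
  qed
  ultimately show ?thesis
    using C(1-4) unfolding Conf ren_conf.simps ext_conf.simps
    by (intro conjI allI impI)
      (simp_all add: process_map Field_ren_rel equiv_ren_rel[OF ginj, unfolded Field_ren_rel]
        dom_ren_hist del: map_prod_imageI)
qed

section \<open>Renaming of extended and weak transitions\<close>

abbreviation ren_elab :: "('k \<Rightarrow> 'k) \<Rightarrow> ('c, 'k) elab \<Rightarrow> ('c, 'k) elab" where
  "ren_elab \<pi> \<equiv> map_elab id \<pi>"

lemma ren_elab_ActE: "ren_elab \<pi> (ActE k a) = ActE (\<pi> k) a"
  by (simp add: map_idents)

lemma ren_trn_Internal: "k \<in> range Internal \<Longrightarrow> ren_trn \<pi> k \<in> range Internal"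
  by auto

lemma raw_estep_ren:
  fixes C :: "('c, 'm, 'k) conf"
  assumes "bij \<pi>" and "raw_estep C \<zeta> C'"
  shows "raw_estep (ren_conf \<pi> C) (ren_elab \<pi> \<zeta>) (ren_conf \<pi> C')"
  using assms(2)
proof cases
  have g: "bij (ren_trn \<pi> :: ('m, 'k) trn \<Rightarrow> ('m, 'k) trn)"
    by (rule bij_ren_trn[OF assms(1)])
  note inj = bij_is_inj[OF g]
  note fresh = inj_image_mem_iff[OF inj]
  {
    case (tau P Q E H)
    show ?thesis
      using step_map[OF inj tau(4)] unfolding tau by (auto intro: raw_estep.tau)
  next
    case (tr_tau P k \<sigma> Q E H)
    have "step (map_tm (ren_trn \<pi>) P) (At (ren_trn \<pi> k) Tau) (map_nsub (ren_trn \<pi>) \<sigma>)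
        (map_tm (ren_trn \<pi>) Q)"
      using step_map[OF inj tr_tau(4)] by simp
    then show ?thesis
      unfolding tr_tau ren_conf.simps sub_eqv_ren[OF g, symmetric] using tr_tau(5,6)
      by (auto simp only: elab.map delta_names_ren fresh intro!: raw_estep.tr_tau ren_trn_Internal)
  next
    case (new P k Q E H)
    have "reconf (map_tm (ren_trn \<pi>) P) (NewL (ren_trn \<pi> k)) (map_tm (ren_trn \<pi>) Q)"
      using reconf_map[OF inj new(4)] by simp
    then show ?thesis
      unfolding new ren_conf.simps using new(5,6)
      by (auto simp only: elab.map delta_names_ren fresh intro!: raw_estep.new ren_trn_Internal)
  next
    case (commit P k Q E H)
    have "reconf (map_tm (ren_trn \<pi>) P) (CoL (ren_trn \<pi> k)) (map_tm (ren_trn \<pi>) Q)"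
      using reconf_map[OF inj commit(4)] by simp
    then show ?thesis
      unfolding commit ren_conf.simps resolve_ren[OF bij_is_inj[OF assms(1)], symmetric] elab.map
      by (rule raw_estep.commit)
  next
    case (abort P k Q E H)
    have "reconf (map_tm (ren_trn \<pi>) P) (AbL (ren_trn \<pi> k)) (map_tm (ren_trn \<pi>) Q)"
      using reconf_map[OF inj abort(4)] by simp
    then show ?thesis
      unfolding abort ren_conf.simps resolve_ren[OF bij_is_inj[OF assms(1)], symmetric] elab.map
      by (rule raw_estep.abort)
  next
    case (tr_act P k a \<sigma> Q E H i)
    have step: "step (map_tm (ren_trn \<pi>) P) (At (External (\<pi> k)) (Act (free_act a)))
        (map_nsub (ren_trn \<pi>) \<sigma>) (map_tm (ren_trn \<pi>) Q)"
      using step_map[OF inj tr_act(4)] by (simp add: map_idents)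
    have fr: "External (\<pi> k) \<notin> delta_names (ren_rel (ren_trn \<pi>) E) (ren_hist \<pi> H)"
      using tr_act(5) fresh[of "External k"] by (simp add: delta_names_ren)
    have H: "ren_hist \<pi> (H(i \<mapsto> (k, Tentative a))) = (ren_hist \<pi> H)(i \<mapsto> (\<pi> k, Tentative a))"
      by auto
    show ?thesis
      unfolding tr_act ren_conf.simps sub_eqv_ren[OF g, symmetric] H ren_elab_ActE
      by (rule raw_estep.tr_act[OF step fr]) (use tr_act(6) in \<open>simp add: dom_ren_hist\<close>)
  next
    case (tr_ab k E H P i a)
    have fr: "External (\<pi> k) \<notin> delta_names (ren_rel (ren_trn \<pi>) E) (ren_hist \<pi> H)"
      "External (\<pi> k) \<notin> ftn (map_tm (ren_trn \<pi>) P)"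
      using tr_ab(4,5) fresh[of "External k"] by (simp_all add: delta_names_ren tm.set_map)
    have H: "ren_hist \<pi> (H(i \<mapsto> (k, Aborted))) = (ren_hist \<pi> H)(i \<mapsto> (\<pi> k, Aborted))"
      "ren_rel (ren_trn \<pi>) (insert (External k, External k) E) =
        insert (External (\<pi> k), External (\<pi> k)) (ren_rel (ren_trn \<pi>) E)"
      by auto
    show ?thesis
      unfolding tr_ab ren_conf.simps H ren_elab_ActE
      by (rule raw_estep.tr_ab[OF fr]) (use tr_ab(6) in \<open>simp add: dom_ren_hist\<close>)
  }
qed

lemma estep_ren:
  "bij \<pi> \<Longrightarrow> estep C \<zeta> C' \<Longrightarrow> estep (ren_conf \<pi> C) (ren_elab \<pi> \<zeta>) (ren_conf \<pi> C')"
  by (simp add: estep_def ext_conf_ren raw_estep_ren)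

lemma tau_steps_ren:
  assumes "bij \<pi>" and "tau_steps C C'"
  shows "tau_steps (ren_conf \<pi> C) (ren_conf \<pi> C')"
  using assms(2) unfolding tau_steps_def
proof (induction rule: rtranclp_induct)
  case (step C' C'')
  then show ?case
    using estep_ren[OF assms(1), of C' TauE C''] by (auto intro: rtranclp.rtrancl_into_rtrancl)
qed simp

lemma weak_ren:
  assumes "bij \<pi>" and "weak C \<zeta> C'"
  shows "weak (ren_conf \<pi> C) (ren_elab \<pi> \<zeta>) (ren_conf \<pi> C')"
proof (cases \<zeta>)
  case (ActE k a)
  then show ?thesis
    using assms(2) estep_ren[OF assms(1), of _ \<zeta>]
    by simp (blast intro: tau_steps_ren[OF assms(1)])
qed (use assms tau_steps_ren in auto)

section \<open>Equivariance of satisfaction\<close>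

lemma form_induct [case_names DiaTau DiaAct Neg Conj HascoF]:
  assumes "\<And>\<phi>. \<Phi> \<phi> \<Longrightarrow> \<Phi> (DiaTau \<phi>)"
    and "\<And>x a \<phi>. \<Phi> \<phi> \<Longrightarrow> \<Phi> (DiaAct x a \<phi>)"
    and "\<And>\<phi>. \<Phi> \<phi> \<Longrightarrow> \<Phi> (Neg \<phi>)"
    and "\<And>f. (\<And>i \<phi>. f i = Some \<phi> \<Longrightarrow> \<Phi> \<phi>) \<Longrightarrow> \<Phi> (Conj f)"
    and "\<And>v. \<Phi> (HascoF v)"
  shows "\<Phi> \<phi>"
proof (induction \<phi>)
  case (Conj f)
  show ?case
  proof (rule assms(4))
    fix i \<phi> assume "f i = Some \<phi>"
    then show "\<Phi> \<phi>" using Conj[OF rangeI[of f i], of \<phi>] by simp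
  qed
qed (use assms in auto)

abbreviation names :: "('c, 'k, 'j) form \<Rightarrow> 'k set" where
  "names \<equiv> set2_form"

abbreviation ren_form :: "('k \<Rightarrow> 'k) \<Rightarrow> ('c, 'k, 'j) form \<Rightarrow> ('c, 'k, 'j) form" where
  "ren_form \<pi> \<equiv> map_form id \<pi>"

lemma ren_form_fsubst: "inj \<pi> \<Longrightarrow> ren_form \<pi> (fsubst l x \<phi>) = fsubst (\<pi> l) x (ren_form \<pi> \<phi>)"
proof (induction \<phi> rule: form_induct)
  case (Conj f)
  then show ?case by (auto simp: option.map_comp intro!: ext option.map_cong)
next
  case (HascoF v)
  then show ?case by (cases v) auto
qed auto

lemma Hasco_ren: "Hasco (ren_conf \<pi> C) = \<pi> ` Hasco C"
  by (cases C) (simp add: Hasco_def HascoH_ren)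

lemma ren_conf_id: "ren_conf id C = C"
  by (cases C) (auto simp: trn.map_id0 tm.map_id prod.map_id0 option.map_id)

lemma ren_conf_comp: "ren_conf \<pi> (ren_conf \<rho> C) = ren_conf (\<pi> \<circ> \<rho>) C"
  by (cases C) (auto simp: trn.map_comp tm.map_comp prod.map_comp option.map_comp image_image
      comp_def id_def intro!: ext option.map_cong)

lemma ren_conf_inv: "bij \<pi> \<Longrightarrow> ren_conf \<pi> (ren_conf (inv \<pi>) C) = C"
  "bij \<pi> \<Longrightarrow> ren_conf (inv \<pi>) (ren_conf \<pi> C) = C"
  by (simp_all add: ren_conf_comp ren_conf_id bij_is_surj bij_is_inj surj_iff[THEN iffD1])

text \<open>The inverse renaming shows that a renamed configuration has no moves besides the renamed
  ones. Satisfaction needs both directions because of negation.\<close>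

lemma weak_ren_iff:
  assumes "bij \<pi>"
  shows "weak (ren_conf \<pi> C) (ren_elab \<pi> \<zeta>) D \<longleftrightarrow> (\<exists>C'. D = ren_conf \<pi> C' \<and> weak C \<zeta> C')"
proof
  have "ren_elab (inv \<pi>) (ren_elab \<pi> \<zeta>) = \<zeta>"
    using assms by (simp add: elab.map_comp bij_is_inj elab.map_id)
  moreover assume "weak (ren_conf \<pi> C) (ren_elab \<pi> \<zeta>) D"
  ultimately have "weak C \<zeta> (ren_conf (inv \<pi>) D)"
    using weak_ren[OF bij_imp_bij_inv[OF assms], of "ren_conf \<pi> C" "ren_elab \<pi> \<zeta>" D]
    by (simp add: ren_conf_inv[OF assms])
  then show "\<exists>C'. D = ren_conf \<pi> C' \<and> weak C \<zeta> C'"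
    using ren_conf_inv(1)[OF assms] by metis
qed (use weak_ren[OF assms] in auto)

text \<open>Induction along \<open>sat\<close> rather than on the formula, so that the hypothesis
  covers the instances \<open>fsubst l x \<phi>\<close> of the body of a modality.\<close>

lemma sat_ren:
  fixes C :: "('c, 'm, 'k) conf"
  assumes "bij \<pi>"
  shows "sat (ren_conf \<pi> C) (ren_form \<pi> \<phi>) \<longleftrightarrow> sat C \<phi>"
proof (induction C \<phi> rule: sat.induct)
  case (1 C \<phi>)
  show ?case
    using weak_ren_iff[OF assms, of C TauE] 1 by auto
next
  case (2 C x a \<phi>)
  have weak: "weak (ren_conf \<pi> C) (ActE (\<pi> l) a) D \<longleftrightarrow>
      (\<exists>C'. D = ren_conf \<pi> C' \<and> weak C (ActE l a) C')" for l D
    using weak_ren_iff[OF assms, of C "ActE l a" D] by (simp only: ren_elab_ActE)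
  have fsubst: "sat (ren_conf \<pi> C') (fsubst (\<pi> l) x (ren_form \<pi> \<phi>)) \<longleftrightarrow>
      sat C' (fsubst l x \<phi>)" for l and C' :: "('c, 'm, 'k) conf"
    unfolding ren_form_fsubst[OF bij_is_inj[OF assms], symmetric] by (rule 2[OF UNIV_I])
  have IH: "(\<exists>D. weak (ren_conf \<pi> C) (ActE (\<pi> l) a) D \<and> sat D (fsubst (\<pi> l) x (ren_form \<pi> \<phi>)))
      \<longleftrightarrow> (\<exists>C'. weak C (ActE l a) C' \<and> sat C' (fsubst l x \<phi>))" for l
    unfolding weak using fsubst by blast
  have cofin: "finite (- (\<pi> ` N)) \<longleftrightarrow> finite (- N)" for N
    using assms
    by (simp add: bij_image_Compl_eq[symmetric] finite_image_iff bij_is_inj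
        inj_on_subset[OF _ subset_UNIV])
  have surj: "\<exists>N. M = \<pi> ` N" for M
    using assms by (metis bij_is_surj surj_image_vimage_eq)
  show ?case (is "_ \<longleftrightarrow> ?R")
  proof -
    have "sat (ren_conf \<pi> C) (ren_form \<pi> (DiaAct x a \<phi>)) \<longleftrightarrow> (\<exists>M. finite (- M) \<and>
      (\<forall>l\<in>M. \<exists>D. weak (ren_conf \<pi> C) (ActE l a) D \<and> sat D (fsubst l x (ren_form \<pi> \<phi>))))"
      by (simp add: act.map_id)
    also have "\<dots> \<longleftrightarrow> (\<exists>N. finite (- \<pi> ` N) \<and> (\<forall>l\<in>\<pi> ` N.
        \<exists>D. weak (ren_conf \<pi> C) (ActE l a) D \<and> sat D (fsubst l x (ren_form \<pi> \<phi>))))"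
      using surj by metis
    also have "\<dots> \<longleftrightarrow> ?R"
      by (simp add: cofin IH del: weak.simps)
    finally show ?thesis .
  qed
next
  case (4 C f)
  then show ?case by (force simp: map_option_case split: option.splits)
next
  case (5 C k)
  then show ?case using assms by (simp add: Hasco_ren inj_image_mem_iff bij_is_inj)
qed simp_all

text \<open>
  A name is abstracted by the variable \<open>0\<close>; all other variables, bound ones included, are shifted
  to keep \<open>0\<close> free, since the formula may use every variable.
\<close>

primrec shift :: "('c, 'k, 'j) form \<Rightarrow> ('c, 'k, 'j) form" where
  "shift (DiaTau \<phi>) = DiaTau (shift \<phi>)"
| "shift (DiaAct y a \<phi>) = DiaAct (Suc y) a (shift \<phi>)"
| "shift (Neg \<phi>) = Neg (shift \<phi>)"
| "shift (Conj f) = Conj (\<lambda>i. map_option shift (f i))"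
| "shift (HascoF v) = HascoF (case v of RName k \<Rightarrow> RName k | RVar x \<Rightarrow> RVar (Suc x))"

lemma shift_fsubst: "shift (fsubst l x \<phi>) = fsubst l (Suc x) (shift \<phi>)"
proof (induction \<phi> rule: form_induct)
  case (Conj f)
  then show ?case by (auto simp: option.map_comp intro!: ext option.map_cong)
next
  case (HascoF v)
  then show ?case by (cases v) auto
qed auto

text \<open>Satisfaction uses a variable only by substituting for it, and \<open>shift\<close>
  commutes with substitution.\<close>

lemma sat_shift: "sat C (shift \<phi>) \<longleftrightarrow> sat C \<phi>"
proof (induction C \<phi> rule: sat.induct)
  case (2 C x a \<phi>)
  then show ?case by (simp add: shift_fsubst[symmetric])
next
  case (4 C f)
  then show ?case by (force simp: map_option_case split: option.splits)
qed simp_all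

primrec abstr :: "'k \<Rightarrow> ('c, 'k, 'j) form \<Rightarrow> ('c, 'k, 'j) form" where
  "abstr k (DiaTau \<phi>) = DiaTau (abstr k \<phi>)"
| "abstr k (DiaAct y a \<phi>) = DiaAct (Suc y) a (abstr k \<phi>)"
| "abstr k (Neg \<phi>) = Neg (abstr k \<phi>)"
| "abstr k (Conj f) = Conj (\<lambda>i. map_option (abstr k) (f i))"
| "abstr k (HascoF v) = HascoF (case v of
     RName k' \<Rightarrow> if k' = k then RVar 0 else RName k' | RVar x \<Rightarrow> RVar (Suc x))"

text \<open>Binders in \<open>abstr k \<phi>\<close> are successors, so none of them stops the
  substitution for \<open>0\<close>. The renaming \<open>id(k := l)\<close> may merge two names; it
  agrees with the swap of \<open>k\<close> and \<open>l\<close> on formulae in which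
  \<open>l\<close> does not occur.\<close>

lemma fsubst_abstr: "fsubst l 0 (abstr k \<phi>) = shift (ren_form (id(k := l)) \<phi>)"
proof (induction \<phi> rule: form_induct)
  case (Conj f)
  then show ?case by (auto simp: option.map_comp intro!: ext option.map_cong)
next
  case (HascoF v)
  then show ?case by (cases v) auto
qed (auto simp: map_idents)

text \<open>Removing \<open>k\<close> brings the formula back within the bound on names that
  \<open>logically_equal\<close> imposes.\<close>

lemma names_abstr: "names (abstr k \<phi>) \<subseteq> names \<phi> - {k}"
proof (induction \<phi> rule: form_induct)
  case (Conj f)
  show ?case
  proof
    fix l assume "l \<in> names (abstr k (Conj f))"
    then obtain i \<phi> where "f i = Some \<phi>" "l \<in> names (abstr k \<phi>)"
      by (auto elim!: rangeE simp: map_option_case split: option.splits)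
    with Conj[of i \<phi>] show "l \<in> names (Conj f) - {k}"
      by (auto intro!: exI[of _ i] bexI[of _ \<phi>])
  qed
next
  case (HascoF v)
  then show ?case by (cases v) auto
qed auto

lemma free_in_simps:
  "free_in x (DiaTau \<phi>) \<longleftrightarrow> free_in x \<phi>"
  "free_in x (DiaAct y a \<phi>) \<longleftrightarrow> free_in x \<phi> \<and> x \<noteq> y"
  "free_in x (Neg \<phi>) \<longleftrightarrow> free_in x \<phi>"
  "free_in x (Conj f) \<longleftrightarrow> (\<exists>i \<phi>. f i = Some \<phi> \<and> free_in x \<phi>)"
  "free_in x (HascoF v) \<longleftrightarrow> v = RVar x"
  by (subst free_in.simps, force)+

lemma free_in_abstr: "free_in x (abstr k \<phi>) \<Longrightarrow> x = 0 \<or> (\<exists>y. x = Suc y \<and> free_in y \<phi>)"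
proof (induction \<phi> arbitrary: x rule: form_induct)
  case (DiaAct y a \<phi>)
  then show ?case by (fastforce simp: free_in_simps)
next
  case (Conj f)
  then show ?case by (fastforce simp: free_in_simps)
next
  case (HascoF v)
  then show ?case by (cases v) (auto simp: free_in_simps split: if_splits)
qed (auto simp: free_in_simps)

lemma closed_DiaAct_abstr: "closed_form \<phi> \<Longrightarrow> closed_form (DiaAct 0 a (abstr k \<phi>))"
  using free_in_abstr by (fastforce simp: closed_form_def free_in_simps)

section \<open>Logical equivalence is a bisimulation\<close>

lemma Htrn_resolve:
  fixes H :: "('c, 'k) hist"
  shows "Htrn (resolve s E k H) = Htrn H"
proof -
  have *: "map_option fst (resolve s E k H i) = map_option fst (H i)" for i
    by (auto simp: resolve_def split: option.split status.split)
  have "k' \<in> Htrn H \<longleftrightarrow> (\<exists>i. map_option fst (H i) = Some k')" for k' and H :: "('c, 'k) hist"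
    by (force simp: Htrn_def ran_def)
  then show ?thesis by (simp only: set_eq_iff * simp_thms)
qed

lemma Htrn_upd: "i \<notin> dom H \<Longrightarrow> Htrn (H(i \<mapsto> (k, s))) = insert k (Htrn H)"
  unfolding domIff not_not Htrn_def by (simp add: ran_map_upd)

text \<open>Commits and aborts change statuses but no names in the history, the other silent steps
  leave it alone, and a visible step adds one entry, for its label.\<close>

lemma Htrn_raw_estep:
  "raw_estep C \<zeta> C' \<Longrightarrow>
    Htrn (hist C') = Htrn (hist C) \<union> (case \<zeta> of TauE \<Rightarrow> {} | ActE k a \<Rightarrow> {k})"
  by (induction rule: raw_estep.induct) (simp_all add: Htrn_resolve Htrn_upd[unfolded fun_upd_def] fun_upd_def)

lemma raw_estep_fresh: "raw_estep C (ActE k a) C' \<Longrightarrow> k \<notin> Htrn (hist C)"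
  by (erule raw_estep.cases) (auto simp: delta_names_def)

lemma tau_steps_inv:
  "tau_steps C C' \<Longrightarrow> ext_conf C \<Longrightarrow> ext_conf C' \<and> Htrn (hist C') = Htrn (hist C)"
  unfolding tau_steps_def
proof (induction rule: rtranclp_induct)
  case (step D D')
  then show ?case using Htrn_raw_estep[of D TauE D'] by (simp add: estep_def)
qed simp

text \<open>Since an empty silent run contains no \<open>estep\<close> to supply
  \<open>ext_conf\<close>, the latter is assumed of the source.\<close>

lemma weak_inv:
  assumes "weak C \<zeta> C'" and "ext_conf C"
  shows "ext_conf C'"
    and "Htrn (hist C') = Htrn (hist C) \<union> (case \<zeta> of TauE \<Rightarrow> {} | ActE k a \<Rightarrow> {k})"
    and "\<zeta> = ActE k a \<Longrightarrow> k \<notin> Htrn (hist C)"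
proof -
  have "ext_conf C' \<and>
    Htrn (hist C') = Htrn (hist C) \<union> (case \<zeta> of TauE \<Rightarrow> {} | ActE k a \<Rightarrow> {k}) \<and>
    (\<zeta> = ActE k a \<longrightarrow> k \<notin> Htrn (hist C))"
  proof (cases \<zeta>)
    case TauE
    then show ?thesis using assms tau_steps_inv[of C C'] by auto
  next
    case (ActE l b)
    then obtain D D' where D: "tau_steps C D" "estep D (ActE l b) D'" "tau_steps D' C'"
      using assms(1) by auto
    have "ext_conf D" "Htrn (hist D) = Htrn (hist C)" "ext_conf D'" "ext_conf C'"
      "Htrn (hist C') = Htrn (hist D')"
      using tau_steps_inv[OF D(1) assms(2)] tau_steps_inv[OF D(3)] D(2)
      by (auto simp: estep_def)
    then show ?thesis
      using D(2) ActE Htrn_raw_estep[of D "ActE l b" D'] raw_estep_fresh[of D l b D']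
      by (auto simp: estep_def)
  qed
  then show "ext_conf C'"
    and "Htrn (hist C') = Htrn (hist C) \<union> (case \<zeta> of TauE \<Rightarrow> {} | ActE k a \<Rightarrow> {k})"
    and "\<zeta> = ActE k a \<Longrightarrow> k \<notin> Htrn (hist C)"
    by blast+
qed

text \<open>Every external name of a configuration is in its history: one in the field of
  \<open>E\<close> is related to itself, hence recorded, and for one in the process this is the
  convention on external names.\<close>

lemma ren_conf_fresh:
  assumes "ext_conf C" and "\<And>k. k \<in> Htrn (hist C) \<Longrightarrow> \<pi> k = k"
  shows "ren_conf \<pi> C = C"
proof (cases C)
  case (Conf E H P)
  have fixed: "ren_trn \<pi> k = k" if "k \<in> Field E \<union> ftn P" for k
  proof (cases k)
    case (External l)
    have "(External l, External l) \<in> E" if "External l \<in> Field E"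
      using assms(1) that unfolding Conf by (auto simp: equiv_def refl_on_def)
    then have "l \<in> Htrn H"
      using that assms(1) unfolding Conf External by auto
    then show ?thesis using assms(2) unfolding Conf External by simp
  qed simp
  have "map_tm (ren_trn \<pi>) P = P"
    using fixed by (intro tm.map_ident_strong) auto
  moreover have "ren_hist \<pi> H = H"
  proof
    fix i show "ren_hist \<pi> H i = H i"
      using assms(2) unfolding Conf by (cases "H i") (force simp: Htrn_def ran_def)+
  qed
  moreover have "map_prod (ren_trn \<pi>) (ren_trn \<pi>) x = x" if "x \<in> E" for x
    using that fixed by (cases x) (auto simp: Field_def)
  then have "ren_rel (ren_trn \<pi>) E = E" by simp
  ultimately show ?thesis using Conf by simp
qed

text \<open>
  The bound on the names is what makes the abstraction of a name sound: for
  \<open>\<phi> = (\<And>l \<noteq> k. \<not> Hasco(l)) \<and> Hasco(k)\<close>, replacing \<open>k\<close> by a variable and instantiating it with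
  another name gives a contradiction.
\<close>

definition logically_equal :: "('c, 'm, 'k) conf \<Rightarrow> ('c, 'm, 'k) conf \<Rightarrow> bool" where
  "logically_equal C D \<longleftrightarrow>
     (\<forall>\<phi> :: ('c, 'k, ('c, 'm, 'k) conf) form. closed_form \<phi> \<longrightarrow>
        names \<phi> \<subseteq> Htrn (hist C) \<union> Htrn (hist D) \<longrightarrow> (sat C \<phi> \<longleftrightarrow> sat D \<phi>))"

lemma logically_equal_sym: "logically_equal C D \<Longrightarrow> logically_equal D C"
  by (simp add: logically_equal_def Un_commute)

text \<open>The conjunction of one separating formula for each member of \<open>X\<close>. Its
  conjuncts are indexed by the configurations themselves, which is why formulae take configurations
  as index type.\<close>

lemma separating_formula:
  fixes C :: "('c, 'm, 'k) conf"
  assumes "\<And>D. D \<in> X \<Longrightarrow> \<not> logically_equal C D"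
    and "\<And>D. D \<in> X \<Longrightarrow> Htrn (hist C) \<union> Htrn (hist D) \<subseteq> S"
  obtains \<phi> :: "('c, 'k, ('c, 'm, 'k) conf) form"
  where "closed_form \<phi>" and "names \<phi> \<subseteq> S" and "sat C \<phi>" and "\<And>D. D \<in> X \<Longrightarrow> \<not> sat D \<phi>"
proof -
  have "\<exists>\<phi> :: ('c, 'k, ('c, 'm, 'k) conf) form.
      closed_form \<phi> \<and> names \<phi> \<subseteq> S \<and> sat C \<phi> \<and> \<not> sat D \<phi>" if D: "D \<in> X" for D
  proof -
    obtain \<phi> :: "('c, 'k, ('c, 'm, 'k) conf) form" where
      \<phi>: "closed_form \<phi>" "names \<phi> \<subseteq> Htrn (hist C) \<union> Htrn (hist D)" "sat C \<phi> \<noteq> sat D \<phi>"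
      using assms(1)[OF D] by (auto simp: logically_equal_def)
    \<comment> \<open>The chosen formula must hold at \<open>C\<close>, so it is negated when it
      holds at \<open>D\<close> instead.\<close>
    have "closed_form (Neg \<phi>)" using \<phi>(1) by (simp add: closed_form_def free_in_simps)
    with \<phi> assms(2)[OF D] show ?thesis
      by (intro exI[of _ "if sat C \<phi> then \<phi> else Neg \<phi>"]) auto
  qed
  then obtain F :: "_ \<Rightarrow> ('c, 'k, ('c, 'm, 'k) conf) form" where
    F: "\<And>D. D \<in> X \<Longrightarrow> closed_form (F D) \<and> names (F D) \<subseteq> S \<and> sat C (F D) \<and> \<not> sat D (F D)"
    by metis
  define \<phi> where "\<phi> = Conj (\<lambda>D. if D \<in> X then Some (F D) else None)"
  show thesis
  proof (rule that)
    show "closed_form \<phi>" "names \<phi> \<subseteq> S"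
      using F by (fastforce simp: \<phi>_def closed_form_def free_in_simps split: if_splits)+
    show "sat C \<phi>" using F by (simp add: \<phi>_def)
    show "\<not> sat D \<phi>" if D: "D \<in> X" for D
      using F[OF D] D by (auto simp: \<phi>_def)
  qed
qed

lemma logically_equal_weak:
  fixes C :: "('c, 'm, 'k::infinite) conf"
  assumes ext: "ext_conf C" "ext_conf D" and eq: "logically_equal C D"
    and weak: "weak C \<zeta> C'" and fresh: "elab_names \<zeta> \<inter> conf_names D = {}"
  shows "\<exists>D'. weak D \<zeta> D' \<and> logically_equal C' D'"
proof (rule ccontr)
  assume contra: "\<nexists>D'. weak D \<zeta> D' \<and> logically_equal C' D'"
  let ?X = "{D'. weak D \<zeta> D'}" and ?S = "Htrn (hist C) \<union> Htrn (hist D)"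
    and ?K = "case \<zeta> of TauE \<Rightarrow> {} | ActE k a \<Rightarrow> {k}"
  obtain \<phi> :: "('c, 'k, ('c, 'm, 'k) conf) form" where \<phi>: "closed_form \<phi>"
    "names \<phi> \<subseteq> ?S \<union> ?K" "sat C' \<phi>" "\<And>D'. weak D \<zeta> D' \<Longrightarrow> \<not> sat D' \<phi>"
  proof (rule separating_formula[where C = C' and X = ?X and S = "?S \<union> ?K"])
    show "Htrn (hist C') \<union> Htrn (hist D') \<subseteq> ?S \<union> ?K" if "D' \<in> ?X" for D'
      using weak_inv(2)[OF weak ext(1)] weak_inv(2)[of D \<zeta> D'] ext(2) that by auto
  qed (use contra in auto)
  show False
  proof (cases \<zeta>)
    case TauE
    have "sat C (DiaTau \<phi>)" using weak \<phi>(3) TauE by auto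
    moreover have "\<not> sat D (DiaTau \<phi>)" using \<phi>(4) TauE by auto
    moreover have "closed_form (DiaTau \<phi>)" "names (DiaTau \<phi>) \<subseteq> ?S"
      using \<phi>(1,2) TauE by (simp_all add: closed_form_def free_in_simps)
    ultimately show False using eq unfolding logically_equal_def by blast
  next
    case (ActE k a)
    \<comment> \<open>For \<open>C\<close> the label is fresh because the move records it anew; for
      \<open>D\<close> this is the side condition of the bisimulation game.\<close>
    have k: "k \<notin> ?S"
      using weak_inv(3)[OF weak ext(1) ActE] fresh ActE
      by (auto simp: conf_names_def delta_names_def)
    have fin: "finite ?S"
      using ext by (cases C; cases D) (auto simp: Htrn_def finite_ran)
    let ?\<psi> = "DiaAct 0 a (abstr k \<phi>)"
    \<comment> \<open>The swap fixes \<open>B\<close> and exchanges its moves labelled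
      \<open>k(a)\<close> and \<open>l(a)\<close>. This is read forwards for \<open>C\<close> and
      backwards for \<open>D\<close>; the case \<open>l = k\<close> is included.\<close>
    have transfer: "sat B' \<phi> \<and> weak B (ActE k a) B' \<longleftrightarrow>
        sat (ren_conf \<pi> B') (fsubst l 0 (abstr k \<phi>)) \<and> weak B (ActE l a) (ren_conf \<pi> B')"
      if "l \<notin> ?S" "ext_conf B" "Htrn (hist B) \<subseteq> ?S" "\<pi> = id(k := l, l := k)" for l B B' \<pi>
    proof -
      have \<pi>: "bij \<pi>" unfolding that(4)
        by (rule o_bij[where g = "id(k := l, l := k)"]) (auto simp: fun_eq_iff)
      have B: "ren_conf \<pi> B = B"
        by (rule ren_conf_fresh[OF that(2)]) (use that k in auto)
      \<comment> \<open>The names of \<open>\<phi>\<close> lie in \<open>?S\<close> together with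
        \<open>k\<close>, so \<open>l\<close> can occur in it only if \<open>l = k\<close>; hence
        the merging renaming acts as the swap.\<close>
      have "ren_form (id(k := l)) \<phi> = ren_form \<pi> \<phi>"
        using that \<phi>(2) ActE by (intro form.map_cong) auto
      then have "sat (ren_conf \<pi> B') (fsubst l 0 (abstr k \<phi>)) \<longleftrightarrow> sat B' \<phi>"
        by (simp add: fsubst_abstr sat_shift sat_ren[OF \<pi>])
      moreover have "weak B (ActE l a) (ren_conf \<pi> B') \<longleftrightarrow> weak B (ActE k a) B'"
      proof -
        have "ren_conf \<pi> B' = ren_conf \<pi> B'' \<Longrightarrow> B' = B''" for B''
          using ren_conf_inv(2)[OF \<pi>] by metis
        moreover have "\<pi> k = l" using that(4) by simp
        ultimately show ?thesis
          using weak_ren_iff[OF \<pi>, of B "ActE k a" "ren_conf \<pi> B'"]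
          unfolding B ren_elab_ActE by auto
      qed
      ultimately show ?thesis by blast
    qed
    have "sat C ?\<psi>"
    proof -
      have "\<exists>C''. weak C (ActE l a) C'' \<and> sat C'' (fsubst l 0 (abstr k \<phi>))" if "l \<in> - ?S" for l
        using transfer[of l C _ C'] that ext(1) weak \<phi>(3) ActE by auto
      \<comment> \<open>The complement of \<open>?S\<close> is cofinite because histories are
        finite.\<close>
      then show ?thesis using fin by (auto intro!: exI[of _ "- ?S"])
    qed
    moreover have "closed_form ?\<psi>" by (rule closed_DiaAct_abstr[OF \<phi>(1)])
    moreover have "names ?\<psi> \<subseteq> ?S" using names_abstr[of k \<phi>] \<phi>(2) ActE by auto
    ultimately have "sat D ?\<psi>" using eq unfolding logically_equal_def by blast
    then obtain N where N: "finite (- N)"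
      "\<And>l. l \<in> N \<Longrightarrow> \<exists>D''. weak D (ActE l a) D'' \<and> sat D'' (fsubst l 0 (abstr k \<phi>))"
      by auto
    have "infinite (UNIV :: 'k set)" by (rule infinite_UNIV)
    \<comment> \<open>The set \<open>N\<close> given by satisfaction may contain names of
      \<open>?S\<close>; infinitely many external names leave one in \<open>N\<close> that avoids
      them.\<close>
    then obtain l where l: "l \<notin> - N \<union> ?S"
      using N(1) fin ex_new_if_finite[of "- N \<union> ?S"] by blast
    then obtain D'' where D'': "weak D (ActE l a) D''" "sat D'' (fsubst l 0 (abstr k \<phi>))"
      using N(2)[of l] by blast
    \<comment> \<open>As the swap is an involution, \<open>D''\<close> is the renaming of
      \<open>ren_conf \<pi> D''\<close>. The latter is thus an answer of \<open>D\<close> to the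
      original label that satisfies \<open>\<phi>\<close>.\<close>
    define \<pi> where "\<pi> = id(k := l, l := k)"
    have "\<pi> \<circ> \<pi> = id" by (auto simp: \<pi>_def fun_eq_iff)
    then have "ren_conf \<pi> (ren_conf \<pi> D'') = D''" by (simp add: ren_conf_comp ren_conf_id)
    then have "sat (ren_conf \<pi> D'') \<phi> \<and> weak D (ActE k a) (ren_conf \<pi> D'')"
      using transfer[of l D \<pi> "ren_conf \<pi> D''"] l D'' ext(2) \<pi>_def by auto
    then show False using \<phi>(4) ActE by blast
  qed
qed

text \<open>A committed name occurs in the history, so the atomic formula on it respects the bound
  on names.\<close>

lemma logically_equal_Hasco:
  assumes "logically_equal C D"
  shows "Hasco C = Hasco D"
proof -
  have "k \<in> Htrn (hist C)" if "k \<in> Hasco C" for k and C :: "('a, 'b, 'c) conf"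
    using that by (force simp: Hasco_def HascoH_def Htrn_def ran_def)
  then have "k \<in> Hasco C \<longleftrightarrow> k \<in> Hasco D" if "k \<in> Hasco C \<union> Hasco D" for k
    using assms[unfolded logically_equal_def, rule_format, of "HascoF (RName k)"] that
    by (auto simp: closed_form_def free_in_simps)
  then show ?thesis by blast
qed

theorem proposition4p5:
  fixes C1 C2 :: "('c::infinite, 'm::infinite, 'k::infinite) conf"
  assumes "ext_conf C1" and "ext_conf C2"
    and "theory_of C1 = theory_of C2"
  shows "(C1, C2) \<in> hasco_bisimilar"
proof -
  let ?R = "{(C, D). ext_conf C \<and> ext_conf D \<and> logically_equal C D} ::
    ('c, 'm, 'k) conf rel"
  have "hasco_bisimulation ?R"
    unfolding hasco_bisimulation_def
  proof (intro allI impI conjI)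
    fix C D :: "('c, 'm, 'k) conf" assume "(C, D) \<in> ?R"
    then have CD: "ext_conf C" "ext_conf D" "logically_equal C D" by simp_all
    then show "ext_conf C" "ext_conf D" "Hasco C = Hasco D"
      by (simp_all add: logically_equal_Hasco)
    show "\<exists>D'. weak D \<zeta> D' \<and> (C', D') \<in> ?R"
      if "weak C \<zeta> C'" "elab_names \<zeta> \<inter> conf_names D = {}" for \<zeta> C'
      using logically_equal_weak[OF CD that] weak_inv(1)[OF that(1) CD(1)] weak_inv(1)[OF _ CD(2)]
      by auto
    \<comment> \<open>The roles of the two configurations are exchanged, using the symmetry of
      \<open>logically_equal\<close> before and after the move.\<close>
    show "\<exists>C'. weak C \<zeta> C' \<and> (C', D') \<in> ?R"
      if "weak D \<zeta> D'" "elab_names \<zeta> \<inter> conf_names C = {}" for \<zeta> D'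
      using logically_equal_weak[OF CD(2,1) logically_equal_sym[OF CD(3)] that]
        weak_inv(1)[OF that(1) CD(2)] weak_inv(1)[OF _ CD(1)] logically_equal_sym
      by simp blast
  qed
  \<comment> \<open>Agreement on all closed formulae includes agreement on those with bounded
    names.\<close>
  moreover have "logically_equal C1 C2"
    using assms(3) by (auto simp: logically_equal_def theory_of_def)
  ultimately show ?thesis
    using assms(1,2) unfolding hasco_bisimilar_def by blast
qed

end
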